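(* (1) Let $A$ be a basic non-semisimple Artin algebra such that every simple left $A$-module and every simple right $A$-module is reflexive. Then $A$ is selfinjective. (2) Let $A$ be a basic non-semisimple Artin algebra with $A \cong A^{op}$ (as algebras), and assume that every simple (right) $A$-module is reflexive. Then $A$ is selfinjective.
   Context: Modules are finitely generated right modules unless stated otherwise; $A^{op}$ is the opposite algebra of $A$. $(-)^{*}$ denotes the functor $\mathrm{Hom}_A(-,A)$, from right $A$-modules to left $A$-modules and from left $A$-modules to right $A$-modules. A (left or right) module $M$ is reflexive if the canonical evaluation map $f_M : M \to M^{**}$, $f_M(m)(g)=g(m)$ for $m\in M$, $g\in M^{*}$, is an isomorphism. $A$ is selfinjective if the regular module $A$ is injective. *)

theory Defs
  imports "HOL-Algebra.Algebra"
begin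

text \<open>
  The locale \<^locale>\<open>module\<close> of HOL-Algebra requires a commutative ring of scalars, so unital
  modules over an arbitrary ring are introduced here, on the same record type (whose fields for
  multiplication and unit are ignored). A right \<open>R\<close>-module is a left module over the opposite
  ring: \<open>a \<odot> x\<close> then stands for \<open>x \<cdot> a\<close>.
\<close>

definition opp :: "('a, 'b) ring_scheme \<Rightarrow> ('a, 'b) ring_scheme" where
  "opp R = R\<lparr>monoid.mult := \<lambda>x y. y \<otimes>\<^bsub>R\<^esub> x\<rparr>"

lemma opp_opp [simp]: "opp (opp R) = R"
  by (simp add: opp_def)

locale left_module = R?: ring R + M?: abelian_group M
  for R :: "('a, 'b) ring_scheme" (structure) and M :: "('a, 'm, 'c) module_scheme" (structure) +
  assumes smult_closed:
      "\<lbrakk>a \<in> carrier R; x \<in> carrier M\<rbrakk> \<Longrightarrow> a \<odot>\<^bsub>M\<^esub> x \<in> carrier M"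
    and smult_l_distr:
      "\<lbrakk>a \<in> carrier R; b \<in> carrier R; x \<in> carrier M\<rbrakk> \<Longrightarrow>
       (a \<oplus>\<^bsub>R\<^esub> b) \<odot>\<^bsub>M\<^esub> x = a \<odot>\<^bsub>M\<^esub> x \<oplus>\<^bsub>M\<^esub> b \<odot>\<^bsub>M\<^esub> x"
    and smult_r_distr:
      "\<lbrakk>a \<in> carrier R; x \<in> carrier M; y \<in> carrier M\<rbrakk> \<Longrightarrow>
       a \<odot>\<^bsub>M\<^esub> (x \<oplus>\<^bsub>M\<^esub> y) = a \<odot>\<^bsub>M\<^esub> x \<oplus>\<^bsub>M\<^esub> a \<odot>\<^bsub>M\<^esub> y"
    and smult_assoc:
      "\<lbrakk>a \<in> carrier R; b \<in> carrier R; x \<in> carrier M\<rbrakk> \<Longrightarrow>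
       (a \<otimes>\<^bsub>R\<^esub> b) \<odot>\<^bsub>M\<^esub> x = a \<odot>\<^bsub>M\<^esub> (b \<odot>\<^bsub>M\<^esub> x)"
    and smult_one:
      "x \<in> carrier M \<Longrightarrow> \<one>\<^bsub>R\<^esub> \<odot>\<^bsub>M\<^esub> x = x"

abbreviation right_module ::
    "('a, 'b) ring_scheme \<Rightarrow> ('a, 'm, 'c) module_scheme \<Rightarrow> bool" where
  "right_module R M \<equiv> left_module (opp R) M"

definition regular_module :: "('a, 'b) ring_scheme \<Rightarrow> ('a, 'a) module" where
  "regular_module R = \<lparr>carrier = carrier R, monoid.mult = monoid.mult R, monoid.one = \<one>\<^bsub>R\<^esub>,
     ring.zero = \<zero>\<^bsub>R\<^esub>, ring.add = ring.add R, smult = monoid.mult R\<rparr>"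

text \<open>Homomorphisms are extensional functions, so that \<open>Hom(M, N)\<close> is the carrier of a module.\<close>

definition mod_hom ::
    "('a, 'b) ring_scheme \<Rightarrow> ('a, 'm, 'c) module_scheme \<Rightarrow> ('a, 'n, 'd) module_scheme \<Rightarrow> ('m \<Rightarrow> 'n) set"
  where
  "mod_hom R M N = {h \<in> carrier M \<rightarrow>\<^sub>E carrier N.
     (\<forall>x\<in>carrier M. \<forall>y\<in>carrier M. h (x \<oplus>\<^bsub>M\<^esub> y) = h x \<oplus>\<^bsub>N\<^esub> h y) \<and>
     (\<forall>a\<in>carrier R. \<forall>x\<in>carrier M. h (a \<odot>\<^bsub>M\<^esub> x) = a \<odot>\<^bsub>N\<^esub> h x)}"

definition mod_iso ::
    "('a, 'b) ring_scheme \<Rightarrow> ('a, 'm, 'c) module_scheme \<Rightarrow> ('a, 'n, 'd) module_scheme \<Rightarrow> ('m \<Rightarrow> 'n) set"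
  where
  "mod_iso R M N = {h \<in> mod_hom R M N. bij_betw h (carrier M) (carrier N)}"

text \<open>
  For a left \<open>R\<close>-module \<open>M\<close>, \<open>dual R M\<close> is \<open>Hom\<^sub>R(M, R)\<close> with the right \<open>R\<close>-module structure
  \<open>(g \<cdot> a)(m) = g(m) a\<close>, i.e. a left module over \<open>opp R\<close>. For a right \<open>R\<close>-module \<open>M\<close>,
  \<open>dual (opp R) M\<close> is \<open>Hom\<^sub>R(M, R)\<close> with the left \<open>R\<close>-module structure \<open>(a \<cdot> g)(m) = a g(m)\<close>.
\<close>

definition dual :: "('a, 'b) ring_scheme \<Rightarrow> ('a, 'm, 'c) module_scheme \<Rightarrow> ('a, 'm \<Rightarrow> 'a) module" where
  "dual R M = \<lparr>carrier = mod_hom R M (regular_module R), monoid.mult = undefined, monoid.one = undefined,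
     ring.zero = (\<lambda>m\<in>carrier M. \<zero>\<^bsub>R\<^esub>),
     ring.add = (\<lambda>g h. \<lambda>m\<in>carrier M. g m \<oplus>\<^bsub>R\<^esub> h m),
     smult = (\<lambda>a g. \<lambda>m\<in>carrier M. g m \<otimes>\<^bsub>R\<^esub> a)\<rparr>"

definition bidual ::
    "('a, 'b) ring_scheme \<Rightarrow> ('a, 'm, 'c) module_scheme \<Rightarrow> ('a, ('m \<Rightarrow> 'a) \<Rightarrow> 'a) module" where
  "bidual R M = dual (opp R) (dual R M)"

definition eval_map ::
    "('a, 'b) ring_scheme \<Rightarrow> ('a, 'm, 'c) module_scheme \<Rightarrow> 'm \<Rightarrow> ('m \<Rightarrow> 'a) \<Rightarrow> 'a" where
  "eval_map R M = (\<lambda>m\<in>carrier M. \<lambda>g\<in>carrier (dual R M). g m)"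

definition reflexive_left :: "('a, 'b) ring_scheme \<Rightarrow> ('a, 'm, 'c) module_scheme \<Rightarrow> bool" where
  "reflexive_left R M \<longleftrightarrow> left_module R M \<and> eval_map R M \<in> mod_iso R M (bidual R M)"

abbreviation reflexive_right :: "('a, 'b) ring_scheme \<Rightarrow> ('a, 'm, 'c) module_scheme \<Rightarrow> bool" where
  "reflexive_right R M \<equiv> reflexive_left (opp R) M"

definition simple_left :: "('a, 'b) ring_scheme \<Rightarrow> ('a, 'm, 'c) module_scheme \<Rightarrow> bool" where
  "simple_left R M \<longleftrightarrow> left_module R M \<and> carrier M \<noteq> {\<zero>\<^bsub>M\<^esub>} \<and>
     (\<forall>H. submodule H R M \<longrightarrow> H = {\<zero>\<^bsub>M\<^esub>} \<or> H = carrier M)"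

abbreviation simple_right :: "('a, 'b) ring_scheme \<Rightarrow> ('a, 'm, 'c) module_scheme \<Rightarrow> bool" where
  "simple_right R M \<equiv> simple_left (opp R) M"

definition indecomposable_module ::
    "('a, 'b) ring_scheme \<Rightarrow> ('a, 'm, 'c) module_scheme \<Rightarrow> bool" where
  "indecomposable_module R M \<longleftrightarrow> left_module R M \<and> carrier M \<noteq> {\<zero>\<^bsub>M\<^esub>} \<and>
     (\<forall>H K. submodule H R M \<and> submodule K R M \<and> H \<inter> K = {\<zero>\<^bsub>M\<^esub>} \<and> H <+>\<^bsub>M\<^esub> K = carrier M
        \<longrightarrow> H = {\<zero>\<^bsub>M\<^esub>} \<or> K = {\<zero>\<^bsub>M\<^esub>})"

text \<open>\<open>M\<close> is the internal direct sum of its submodules \<open>P 0, \<dots>, P (n - 1)\<close>.\<close>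

definition internal_direct_sum ::
    "('a, 'b) ring_scheme \<Rightarrow> ('a, 'm, 'c) module_scheme \<Rightarrow> nat \<Rightarrow> (nat \<Rightarrow> 'm set) \<Rightarrow> bool" where
  "internal_direct_sum R M n P \<longleftrightarrow> (\<forall>i<n. submodule (P i) R M) \<and>
     (\<forall>x\<in>carrier M. \<exists>!c. c \<in> (\<Pi>\<^sub>E i\<in>{..<n}. P i) \<and> x = (\<Oplus>\<^bsub>M\<^esub>i\<in>{..<n}. c i))"

text \<open>A finitely generated module is semisimple if it is a (finite) direct sum of simple modules.\<close>

definition semisimple_ring :: "('a, 'b) ring_scheme \<Rightarrow> bool" where
  "semisimple_ring R \<longleftrightarrow> (let M = regular_module (opp R) in
     \<exists>n P. internal_direct_sum (opp R) M n P \<and> (\<forall>i<n. simple_right R (M\<lparr>carrier := P i\<rparr>)))"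

text \<open>
  A ring is basic if its right regular module is a direct sum of pairwise non-isomorphic
  indecomposable modules. For Artin algebras such decompositions are unique by the
  Krull-Schmidt theorem, so requiring one such decomposition is enough.
\<close>

definition basic_ring :: "('a, 'b) ring_scheme \<Rightarrow> bool" where
  "basic_ring R \<longleftrightarrow> (let M = regular_module (opp R) in
     \<exists>n P. internal_direct_sum (opp R) M n P \<and>
       (\<forall>i<n. indecomposable_module (opp R) (M\<lparr>carrier := P i\<rparr>)) \<and>
       (\<forall>i<n. \<forall>j<n. i \<noteq> j \<longrightarrow> mod_iso (opp R) (M\<lparr>carrier := P i\<rparr>) (M\<lparr>carrier := P j\<rparr>) = {}))"

text \<open>
  HOL cannot quantify over the types of the test modules \<open>M\<close> and \<open>N\<close> inside a formula, so they
  are parameters. A theorem concluding injectivity for type variables \<open>'m\<close> and \<open>'n\<close> states it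
  for test modules of arbitrary types.
\<close>

definition injective_module ::
    "'m itself \<Rightarrow> 'n itself \<Rightarrow> ('a, 'b) ring_scheme \<Rightarrow> ('a, 'e, 'c) module_scheme \<Rightarrow> bool" where
  "injective_module _ _ R E \<longleftrightarrow> left_module R E \<and>
     (\<forall>(M :: ('a, 'm) module) (N :: ('a, 'n) module) i f.
        left_module R M \<and> left_module R N \<and>
        i \<in> mod_hom R M N \<and> inj_on i (carrier M) \<and> f \<in> mod_hom R M E \<longrightarrow>
        (\<exists>g \<in> mod_hom R N E. \<forall>x\<in>carrier M. g (i x) = f x))"

definition selfinjective :: "'m itself \<Rightarrow> 'n itself \<Rightarrow> ('a, 'b) ring_scheme \<Rightarrow> bool" where
  "selfinjective tm tn R \<longleftrightarrow> injective_module tm tn (opp R) (regular_module (opp R))"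

definition artinian_cring :: "('k, 'b) ring_scheme \<Rightarrow> bool" where
  "artinian_cring K \<longleftrightarrow> cring K \<and>
     (\<forall>I :: nat \<Rightarrow> 'k set. (\<forall>n. ideal (I n) K \<and> I (Suc n) \<subseteq> I n) \<longrightarrow> (\<exists>n. \<forall>m\<ge>n. I m = I n))"

text \<open>
  An Artin algebra over \<open>K\<close>. The locale \<^locale>\<open>algebra\<close> of HOL-Algebra is not applicable, since it
  makes \<open>A\<close> commutative.
\<close>

definition artin_algebra :: "('k, 'b) ring_scheme \<Rightarrow> ('k, 'a) module \<Rightarrow> bool" where
  "artin_algebra K A \<longleftrightarrow> artinian_cring K \<and> ring A \<and> module K A \<and>
     (\<forall>r\<in>carrier K. \<forall>x\<in>carrier A. \<forall>y\<in>carrier A.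
        (r \<odot>\<^bsub>A\<^esub> x) \<otimes>\<^bsub>A\<^esub> y = r \<odot>\<^bsub>A\<^esub> (x \<otimes>\<^bsub>A\<^esub> y) \<and>
        x \<otimes>\<^bsub>A\<^esub> (r \<odot>\<^bsub>A\<^esub> y) = r \<odot>\<^bsub>A\<^esub> (x \<otimes>\<^bsub>A\<^esub> y)) \<and>
     (\<exists>S. finite S \<and> S \<subseteq> carrier A \<and>
        (\<forall>x\<in>carrier A. \<exists>c \<in> S \<rightarrow> carrier K. x = (\<Oplus>\<^bsub>A\<^esub>s\<in>S. c s \<odot>\<^bsub>A\<^esub> s)))"

definition algebra_iso ::
    "('k, 'b) ring_scheme \<Rightarrow> ('k, 'a) module \<Rightarrow> ('k, 'c) module \<Rightarrow> ('a \<Rightarrow> 'c) set" where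
  "algebra_iso K A B = {h \<in> ring_iso A B.
     \<forall>r\<in>carrier K. \<forall>x\<in>carrier A. h (r \<odot>\<^bsub>A\<^esub> x) = r \<odot>\<^bsub>B\<^esub> h x}"

text \<open>
  Every simple left (right) \<open>R\<close>-module is isomorphic to \<open>R/I\<close> for a maximal left (right) ideal \<open>I\<close>,
  whose elements are cosets, i.e. subsets of the carrier of \<open>R\<close>. Up to isomorphism, all simple
  modules therefore occur on the type \<open>'a set\<close>.
\<close>

definition all_simple_left_reflexive :: "('a, 'b) ring_scheme \<Rightarrow> bool" where
  "all_simple_left_reflexive R \<longleftrightarrow>
     (\<forall>S :: ('a, 'a set) module. simple_left R S \<longrightarrow> reflexive_left R S)"

definition all_simple_right_reflexive :: "('a, 'b) ring_scheme \<Rightarrow> bool" where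
  "all_simple_right_reflexive R \<longleftrightarrow>
     (\<forall>S :: ('a, 'a set) module. simple_right R S \<longrightarrow> reflexive_right R S)"

end

theory Submission
  imports Defs
begin

text \<open>
  For a maximal left ideal \<open>I\<close> the dual of the simple module \<open>R/I\<close> is the right annihilator of
  \<open>I\<close>, so reflexivity of all simple modules is a statement about annihilators. Given it on both
  sides, the dual of a simple module is simple. Hence, along a composition series of left ideals,
  the right annihilators decrease by simple factors or not at all; since \<open>I\<close> grows strictly and a
  double annihilator can grow only by simple factors as well, the annihilators decrease strictly
  and every left ideal is a double annihilator. A linear map \<open>I \<rightarrow> R\<close> that vanishes on \<open>J\<close>, where
  \<open>I/J\<close> is simple, is then right multiplication by an element of the right annihilator of \<open>J\<close>.
  By induction every linear map \<open>I \<rightarrow> R\<close> is a right multiplication, and Baer's criterion applies.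
  The argument is run for \<open>R\<close> the opposite of \<open>A\<close>.
\<close>

section \<open>Chain conditions\<close>

text \<open>No length is ever computed: \<open>covers R J I\<close> expresses that
  \<open>I/J\<close> is simple, and well-founded inclusion does the rest. Descending chains carry
  the induction on left ideals; ascending chains supply, below a nonzero \<open>I\<close>, some
  \<open>J\<close> that it covers. Taking annihilators exchanges left and right ideals, so all
  conditions are kept on both sides. They are not part of the definition of an Artin algebra, which
  speaks only about descending chains of ideals of the base ring \<open>K\<close>: descent is lifted
  from \<open>K\<close> to the finitely generated \<open>K\<close>-module \<open>A\<close>, turned
  into ascent there, and restricted to one-sided ideals, which are \<open>K\<close>-submodules.
  Reflexivity enters with its two halves on opposite sides. Injectivity of evaluation on one side
  embeds a simple module into the ring; surjectivity on the other side turns a linear map on an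
  annihilator into a multiplication. Both halves are phrased with ideals and elements, so that
  changing sides means replacing \<open>R\<close> by \<open>opp R\<close> and an isomorphism with
  the opposite ring can be applied without transporting modules.\<close>

definition dcc_on :: "'a set set \<Rightarrow> bool" where
  "dcc_on F \<longleftrightarrow> wf {(U, Y). U \<in> F \<and> Y \<in> F \<and> U \<subset> Y}"

definition acc_on :: "'a set set \<Rightarrow> bool" where
  "acc_on F \<longleftrightarrow> wf {(Y, U). U \<in> F \<and> Y \<in> F \<and> U \<subset> Y}"

lemma dcc_on_subset: "dcc_on G \<Longrightarrow> F \<subseteq> G \<Longrightarrow> dcc_on F"
  unfolding dcc_on_def by (erule wf_subset) auto

lemma acc_on_subset: "acc_on G \<Longrightarrow> F \<subseteq> G \<Longrightarrow> acc_on F"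
  unfolding acc_on_def by (erule wf_subset) auto

text \<open>The pair \<open>(f U, g U)\<close> strictly decreases in a lexicographic product of two
  well-founded orders. In the applications \<open>f\<close> is intersection with a submodule and
  \<open>g\<close> records the image in the quotient by it, so this is the order-theoretic core of
  passing a chain condition from submodule and quotient to the whole module; the last hypothesis is
  the modular-law step.\<close>

lemma dcc_on_lift:
  assumes "dcc_on F" "dcc_on G"
    and "\<And>U. U \<in> E \<Longrightarrow> f U \<in> F" "\<And>U. U \<in> E \<Longrightarrow> g U \<in> G"
    and "\<And>U Y. U \<in> E \<Longrightarrow> Y \<in> E \<Longrightarrow> U \<subseteq> Y \<Longrightarrow> f U \<subseteq> f Y"
    and "\<And>U Y. U \<in> E \<Longrightarrow> Y \<in> E \<Longrightarrow> U \<subseteq> Y \<Longrightarrow> g U \<subseteq> g Y"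
    and "\<And>U Y. U \<in> E \<Longrightarrow> Y \<in> E \<Longrightarrow> U \<subseteq> Y \<Longrightarrow> f U = f Y \<Longrightarrow> g U = g Y \<Longrightarrow> Y \<subseteq> U"
  shows "dcc_on E"
  unfolding dcc_on_def
proof (rule wf_subset)
  show "wf (inv_image ({(U, Y). U \<in> F \<and> Y \<in> F \<and> U \<subset> Y} <*lex*> {(U, Y). U \<in> G \<and> Y \<in> G \<and> U \<subset> Y})
      (\<lambda>U. (f U, g U)))"
    using assms(1,2) unfolding dcc_on_def by blast
  show "{(U, Y). U \<in> E \<and> Y \<in> E \<and> U \<subset> Y} \<subseteq>
    inv_image ({(U, Y). U \<in> F \<and> Y \<in> F \<and> U \<subset> Y} <*lex*> {(U, Y). U \<in> G \<and> Y \<in> G \<and> U \<subset> Y})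
      (\<lambda>U. (f U, g U))"
  proof (rule subrelI)
    fix U Y assume "(U, Y) \<in> {(U, Y). U \<in> E \<and> Y \<in> E \<and> U \<subset> Y}"
    then have "U \<in> E" "Y \<in> E" and lt: "U \<subset> Y" by auto
    then have "f U \<in> F" "f Y \<in> F" "g U \<in> G" "g Y \<in> G" "f U \<subseteq> f Y" "g U \<subseteq> g Y"
      using assms(3-6) by (simp_all add: less_imp_le)
    moreover have "f U \<noteq> f Y \<or> g U \<noteq> g Y"
      using assms(7) \<open>U \<in> E\<close> \<open>Y \<in> E\<close> lt by blast
    ultimately show "(U, Y) \<in>
      inv_image ({(U, Y). U \<in> F \<and> Y \<in> F \<and> U \<subset> Y} <*lex*> {(U, Y). U \<in> G \<and> Y \<in> G \<and> U \<subset> Y})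
        (\<lambda>U. (f U, g U))"
      by (auto simp: inv_image_def psubset_eq)
  qed
qed

lemma acc_on_lift:
  assumes "acc_on F" "acc_on G"
    and "\<And>U. U \<in> E \<Longrightarrow> f U \<in> F" "\<And>U. U \<in> E \<Longrightarrow> g U \<in> G"
    and "\<And>U Y. U \<in> E \<Longrightarrow> Y \<in> E \<Longrightarrow> U \<subseteq> Y \<Longrightarrow> f U \<subseteq> f Y"
    and "\<And>U Y. U \<in> E \<Longrightarrow> Y \<in> E \<Longrightarrow> U \<subseteq> Y \<Longrightarrow> g U \<subseteq> g Y"
    and "\<And>U Y. U \<in> E \<Longrightarrow> Y \<in> E \<Longrightarrow> U \<subseteq> Y \<Longrightarrow> f U = f Y \<Longrightarrow> g U = g Y \<Longrightarrow> Y \<subseteq> U"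
  shows "acc_on E"
  unfolding acc_on_def
proof (rule wf_subset)
  show "wf (inv_image ({(Y, U). U \<in> F \<and> Y \<in> F \<and> U \<subset> Y} <*lex*> {(Y, U). U \<in> G \<and> Y \<in> G \<and> U \<subset> Y})
      (\<lambda>U. (f U, g U)))"
    using assms(1,2) unfolding acc_on_def by blast
  show "{(Y, U). U \<in> E \<and> Y \<in> E \<and> U \<subset> Y} \<subseteq>
    inv_image ({(Y, U). U \<in> F \<and> Y \<in> F \<and> U \<subset> Y} <*lex*> {(Y, U). U \<in> G \<and> Y \<in> G \<and> U \<subset> Y})
      (\<lambda>U. (f U, g U))"
  proof (rule subrelI)
    fix Y U assume "(Y, U) \<in> {(Y, U). U \<in> E \<and> Y \<in> E \<and> U \<subset> Y}"
    then have "U \<in> E" "Y \<in> E" and lt: "U \<subset> Y" by auto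
    then have "f U \<in> F" "f Y \<in> F" "g U \<in> G" "g Y \<in> G" "f U \<subseteq> f Y" "g U \<subseteq> g Y"
      using assms(3-6) by (simp_all add: less_imp_le)
    moreover have "f U \<noteq> f Y \<or> g U \<noteq> g Y"
      using assms(7) \<open>U \<in> E\<close> \<open>Y \<in> E\<close> lt by blast
    ultimately show "(Y, U) \<in>
      inv_image ({(Y, U). U \<in> F \<and> Y \<in> F \<and> U \<subset> Y} <*lex*> {(Y, U). U \<in> G \<and> Y \<in> G \<and> U \<subset> Y})
        (\<lambda>U. (f U, g U))"
      by (auto simp: inv_image_def psubset_eq)
  qed
qed

lemma dcc_onE_min:
  assumes "dcc_on F" "U \<in> F" "P U"
  obtains Y where "Y \<in> F" "P Y" "\<And>Z. Z \<in> F \<Longrightarrow> Z \<subset> Y \<Longrightarrow> \<not> P Z"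
proof -
  obtain Y where Y: "Y \<in> {Y \<in> F. P Y}"
      "\<And>Z. (Z, Y) \<in> {(U, Y). U \<in> F \<and> Y \<in> F \<and> U \<subset> Y} \<Longrightarrow> Z \<notin> {Y \<in> F. P Y}"
    using assms wfE_min[OF assms(1)[unfolded dcc_on_def], of U "{Y \<in> F. P Y}"] by blast
  show thesis
  proof (rule that)
    show "\<not> P Z" if "Z \<in> F" "Z \<subset> Y" for Z
      using Y(2)[of Z] Y(1) that by blast
  qed (use Y(1) in auto)
qed

lemma dcc_on_induct [consumes 2, case_names less]:
  assumes "dcc_on F" "I \<in> F"
    and "\<And>I. I \<in> F \<Longrightarrow> (\<And>J. J \<in> F \<Longrightarrow> J \<subset> I \<Longrightarrow> P J) \<Longrightarrow> P I"
  shows "P I"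
  by (rule ccontr, rule dcc_onE_min[OF assms(1,2), of "\<lambda>I. \<not> P I"]) (use assms(3) in blast)+

lemma acc_onE_max:
  assumes "acc_on F" "U \<in> F" "P U"
  obtains Y where "Y \<in> F" "P Y" "\<And>Z. Z \<in> F \<Longrightarrow> Y \<subset> Z \<Longrightarrow> \<not> P Z"
proof -
  obtain Y where Y: "Y \<in> {Y \<in> F. P Y}"
      "\<And>Z. (Z, Y) \<in> {(Y, U). U \<in> F \<and> Y \<in> F \<and> U \<subset> Y} \<Longrightarrow> Z \<notin> {Y \<in> F. P Y}"
    using assms wfE_min[OF assms(1)[unfolded acc_on_def], of U "{Y \<in> F. P Y}"] by blast
  show thesis
  proof (rule that)
    show "\<not> P Z" if "Z \<in> F" "Y \<subset> Z" for Z
      using Y(2)[of Z] Y(1) that by blast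
  qed (use Y(1) in auto)
qed

lemma finite_imp_acc_on:
  assumes "finite F"
  shows "acc_on F"
  unfolding acc_on_def
proof (rule finite_acyclic_wf)
  show "finite {(Y, U). U \<in> F \<and> Y \<in> F \<and> U \<subset> Y}"
    by (rule finite_subset[of _ "F \<times> F"]) (use assms in auto)
  have "trans {(Y, U). U \<in> F \<and> Y \<in> F \<and> U \<subset> Y}"
    by (auto simp: trans_def)
  then show "acyclic {(Y, U). U \<in> F \<and> Y \<in> F \<and> U \<subset> Y}"
    by (simp add: acyclic_def)
qed

lemma finite_imp_dcc_on:
  assumes "finite F"
  shows "dcc_on F"
proof -
  have "trans {(U, Y). U \<in> F \<and> Y \<in> F \<and> U \<subset> Y}"
    by (auto simp: trans_def)
  moreover have "finite {(U, Y). U \<in> F \<and> Y \<in> F \<and> U \<subset> Y}"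
    by (rule finite_subset[of _ "F \<times> F"]) (use assms in auto)
  ultimately show ?thesis
    unfolding dcc_on_def by (intro finite_acyclic_wf) (simp_all add: acyclic_def)
qed

lemma artinian_cring_dcc:
  assumes "artinian_cring K"
  shows "dcc_on {I. ideal I K}"
  unfolding dcc_on_def wf_iff_no_infinite_down_chain
proof
  assume "\<exists>I. \<forall>n. (I (Suc n), I n) \<in> {(U, Y). U \<in> {I. ideal I K} \<and> Y \<in> {I. ideal I K} \<and> U \<subset> Y}"
  then obtain I where I: "\<forall>n. (I (Suc n), I n) \<in> {(U, Y). U \<in> {I. ideal I K} \<and> Y \<in> {I. ideal I K} \<and> U \<subset> Y}" ..
  then have *: "ideal (I n) K" "I (Suc n) \<subset> I n" for n
    by simp_all
  have "\<forall>n. ideal (I n) K \<and> I (Suc n) \<subseteq> I n"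
    using *(1) psubset_imp_subset[OF *(2)] by blast
  then have "\<exists>n. \<forall>m\<ge>n. I m = I n"
    by (rule assms[unfolded artinian_cring_def, THEN conjunct2, THEN spec, THEN mp])
  then obtain n where n: "\<forall>m\<ge>n. I m = I n" ..
  have "I (Suc n) = I n" by (rule n[rule_format]) simp
  with *(2)[of n] show False by simp
qed

section \<open>Chain conditions for modules over a commutative ring\<close>

context module
begin

abbreviation submods :: "'c set \<Rightarrow> 'c set set" where
  "submods N \<equiv> {U. submodule U R M \<and> U \<subseteq> N}"

lemma submoduleD:
  assumes "submodule H R M"
  shows "\<And>x. x \<in> H \<Longrightarrow> x \<in> carrier M"
    and "\<zero>\<^bsub>M\<^esub> \<in> H"
    and "\<And>x. x \<in> H \<Longrightarrow> \<ominus>\<^bsub>M\<^esub> x \<in> H"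
    and "\<And>x y. x \<in> H \<Longrightarrow> y \<in> H \<Longrightarrow> x \<oplus>\<^bsub>M\<^esub> y \<in> H"
    and "\<And>x y. x \<in> H \<Longrightarrow> y \<in> H \<Longrightarrow> x \<ominus>\<^bsub>M\<^esub> y \<in> H"
    and "\<And>a x. a \<in> carrier R \<Longrightarrow> x \<in> H \<Longrightarrow> a \<odot>\<^bsub>M\<^esub> x \<in> H"
  using submoduleE[OF assms] subgroup.one_closed[OF submodule.axioms(1)[OF assms]]
  by (auto simp: a_minus_def)

lemma submoduleI':
  assumes "H \<subseteq> carrier M" "\<zero>\<^bsub>M\<^esub> \<in> H"
    and "\<And>a b. \<lbrakk>a \<in> H; b \<in> H\<rbrakk> \<Longrightarrow> a \<oplus>\<^bsub>M\<^esub> b \<in> H"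
    and "\<And>a x. \<lbrakk>a \<in> carrier R; x \<in> H\<rbrakk> \<Longrightarrow> a \<odot>\<^bsub>M\<^esub> x \<in> H"
  shows "submodule H R M"
proof (rule submoduleI)
  fix a assume "a \<in> H"
  then have "\<ominus>\<^bsub>M\<^esub> a = (\<ominus> \<one>) \<odot>\<^bsub>M\<^esub> a"
    using assms(1) by (simp add: smult_l_minus subset_eq)
  then show "\<ominus>\<^bsub>M\<^esub> a \<in> H"
    using assms(4) \<open>a \<in> H\<close> by simp
qed (use assms in auto)

lemma submodule_Int:
  assumes "submodule U R M" "submodule Y R M"
  shows "submodule (U \<inter> Y) R M"
  using submoduleD[OF assms(1)] submoduleD[OF assms(2)] by (intro submoduleI') auto

lemma submodule_add_cyclic:
  assumes N: "submodule N R M" and s: "s \<in> carrier M"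
  shows "submodule {n \<oplus>\<^bsub>M\<^esub> r \<odot>\<^bsub>M\<^esub> s | n r. n \<in> N \<and> r \<in> carrier R} R M" (is "submodule ?H R M")
    and "N \<subseteq> {n \<oplus>\<^bsub>M\<^esub> r \<odot>\<^bsub>M\<^esub> s | n r. n \<in> N \<and> r \<in> carrier R}"
    and "s \<in> {n \<oplus>\<^bsub>M\<^esub> r \<odot>\<^bsub>M\<^esub> s | n r. n \<in> N \<and> r \<in> carrier R}"
proof -
  note ND = submoduleD[OF N]
  show 1: "N \<subseteq> ?H"
    using s ND(1) by (force intro: exI[of _ \<zero>])
  have "s = \<zero>\<^bsub>M\<^esub> \<oplus>\<^bsub>M\<^esub> \<one> \<odot>\<^bsub>M\<^esub> s"
    using s by simp
  then show "s \<in> ?H"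
    using ND(2) by blast
  show "submodule ?H R M"
  proof (rule submoduleI')
    show "?H \<subseteq> carrier M" using s ND(1) by auto
    show "\<zero>\<^bsub>M\<^esub> \<in> ?H" using 1 ND(2) by blast
  next
    fix a b assume "a \<in> ?H" "b \<in> ?H"
    then obtain n r m t where *: "a = n \<oplus>\<^bsub>M\<^esub> r \<odot>\<^bsub>M\<^esub> s" "n \<in> N" "r \<in> carrier R"
      "b = m \<oplus>\<^bsub>M\<^esub> t \<odot>\<^bsub>M\<^esub> s" "m \<in> N" "t \<in> carrier R" by blast
    then have "a \<oplus>\<^bsub>M\<^esub> b = (n \<oplus>\<^bsub>M\<^esub> m) \<oplus>\<^bsub>M\<^esub> (r \<oplus> t) \<odot>\<^bsub>M\<^esub> s"
      using s ND(1) by (simp add: smult_l_distr M.a_ac)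
    then show "a \<oplus>\<^bsub>M\<^esub> b \<in> ?H"
      using * ND(4) by blast
  next
    fix a x assume "a \<in> carrier R" "x \<in> ?H"
    then obtain n r where *: "x = n \<oplus>\<^bsub>M\<^esub> r \<odot>\<^bsub>M\<^esub> s" "n \<in> N" "r \<in> carrier R" by blast
    then have "a \<odot>\<^bsub>M\<^esub> x = (a \<odot>\<^bsub>M\<^esub> n) \<oplus>\<^bsub>M\<^esub> (a \<otimes> r) \<odot>\<^bsub>M\<^esub> s"
      using s ND(1) \<open>a \<in> carrier R\<close> by (simp add: smult_r_distr smult_assoc1)
    then show "a \<odot>\<^bsub>M\<^esub> x \<in> ?H"
      using * \<open>a \<in> carrier R\<close> ND(6) by blast
  qed
qed

text \<open>This is the colon ideal \<open>(N + U : s)\<close>. For \<open>U\<close> inside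
  \<open>N + R s\<close> it describes the image of \<open>U\<close> in the cyclic module
  \<open>(N + R s)/N\<close>, pulled back to \<open>R\<close>, without forming the quotient.\<close>

lemma ideal_relative_colon:
  assumes N: "submodule N R M" and U: "submodule U R M" and s: "s \<in> carrier M"
  shows "ideal {r \<in> carrier R. \<exists>n\<in>N. n \<oplus>\<^bsub>M\<^esub> r \<odot>\<^bsub>M\<^esub> s \<in> U} R" (is "ideal ?I R")
proof -
  note ND = submoduleD[OF N] and UD = submoduleD[OF U]
  have mult: "a \<otimes> r \<in> ?I" if a: "a \<in> carrier R" and r: "r \<in> ?I" for a r
  proof -
    obtain n where n: "n \<in> N" "n \<oplus>\<^bsub>M\<^esub> r \<odot>\<^bsub>M\<^esub> s \<in> U" and r: "r \<in> carrier R"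
      using r by blast
    have "a \<odot>\<^bsub>M\<^esub> n \<oplus>\<^bsub>M\<^esub> (a \<otimes> r) \<odot>\<^bsub>M\<^esub> s = a \<odot>\<^bsub>M\<^esub> (n \<oplus>\<^bsub>M\<^esub> r \<odot>\<^bsub>M\<^esub> s)"
      using n(1) r a s ND(1) by (simp add: smult_r_distr smult_assoc1)
    then have "a \<odot>\<^bsub>M\<^esub> n \<oplus>\<^bsub>M\<^esub> (a \<otimes> r) \<odot>\<^bsub>M\<^esub> s \<in> U"
      using UD(6)[OF a n(2)] by simp
    moreover have "a \<odot>\<^bsub>M\<^esub> n \<in> N" "a \<otimes> r \<in> carrier R" using ND(6) n a r by auto
    ultimately show ?thesis by blast
  qed
  show ?thesis
  proof (rule idealI)
    show "subgroup ?I (add_monoid R)"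
    proof (rule group.subgroupI)
      show "group (add_monoid R)" by (rule R.a_group)
      show "?I \<subseteq> carrier (add_monoid R)" by auto
      have "\<zero>\<^bsub>M\<^esub> \<oplus>\<^bsub>M\<^esub> \<zero> \<odot>\<^bsub>M\<^esub> s \<in> U" using s UD(2) by simp
      then have "\<zero> \<in> ?I" using ND(2) by blast
      then show "?I \<noteq> {}" by blast
    next
      fix a assume a: "a \<in> ?I"
      have "\<ominus> a = (\<ominus> \<one>) \<otimes> a" using a by (simp add: R.l_minus)
      then show "inv\<^bsub>add_monoid R\<^esub> a \<in> ?I"
        using mult[of "\<ominus> \<one>" a] a by (simp add: a_inv_def)
    next
      fix a b assume a: "a \<in> ?I" and b: "b \<in> ?I"
      obtain n m where *: "n \<in> N" "n \<oplus>\<^bsub>M\<^esub> a \<odot>\<^bsub>M\<^esub> s \<in> U" "m \<in> N" "m \<oplus>\<^bsub>M\<^esub> b \<odot>\<^bsub>M\<^esub> s \<in> U"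
        using a b by blast
      have ab: "a \<in> carrier R" "b \<in> carrier R" using a b by blast+
      have "(n \<oplus>\<^bsub>M\<^esub> m) \<oplus>\<^bsub>M\<^esub> (a \<oplus> b) \<odot>\<^bsub>M\<^esub> s = (n \<oplus>\<^bsub>M\<^esub> a \<odot>\<^bsub>M\<^esub> s) \<oplus>\<^bsub>M\<^esub> (m \<oplus>\<^bsub>M\<^esub> b \<odot>\<^bsub>M\<^esub> s)"
        using * ab s ND(1) by (simp add: smult_l_distr M.a_ac)
      moreover have "\<dots> \<in> U" using UD(4) * by blast
      moreover have "n \<oplus>\<^bsub>M\<^esub> m \<in> N" using ND(4) * by blast
      moreover have "a \<oplus> b \<in> carrier R" using a b by blast
      ultimately have "a \<oplus> b \<in> ?I" by (metis (mono_tags, lifting) mem_Collect_eq)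
      then show "a \<otimes>\<^bsub>add_monoid R\<^esub> b \<in> ?I" by simp
    qed
    fix a x assume ax: "a \<in> ?I" "x \<in> carrier R"
    then show "x \<otimes> a \<in> ?I" by (rule mult[rotated])
    moreover have "a \<otimes> x = x \<otimes> a" using ax R.m_comm by blast
    ultimately show "a \<otimes> x \<in> ?I" by (simp only:)
  qed (rule R.ring_axioms)
qed

text \<open>Comparable submodules of \<open>N + R s\<close> are equal as soon as they have the same
  intersection with \<open>N\<close> and the same colon ideal, and both of these invariants live in
  families with descending chains.\<close>

lemma dcc_add_cyclic:
  assumes R: "dcc_on {I. ideal I R}"
    and N: "submodule N R M" "dcc_on (submods N)" and s: "s \<in> carrier M"
  shows "dcc_on (submods {n \<oplus>\<^bsub>M\<^esub> r \<odot>\<^bsub>M\<^esub> s | n r. n \<in> N \<and> r \<in> carrier R})"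
proof (rule dcc_on_lift[OF N(2) R, where f="\<lambda>U. U \<inter> N"
      and g="\<lambda>U. {r \<in> carrier R. \<exists>n\<in>N. n \<oplus>\<^bsub>M\<^esub> r \<odot>\<^bsub>M\<^esub> s \<in> U}"])
  note ND = submoduleD[OF N(1)]
  fix U Y
  assume U: "U \<in> submods {n \<oplus>\<^bsub>M\<^esub> r \<odot>\<^bsub>M\<^esub> s | n r. n \<in> N \<and> r \<in> carrier R}"
    and Y: "Y \<in> submods {n \<oplus>\<^bsub>M\<^esub> r \<odot>\<^bsub>M\<^esub> s | n r. n \<in> N \<and> r \<in> carrier R}"
    and "U \<subseteq> Y" and f: "U \<inter> N = Y \<inter> N"
    and g: "{r \<in> carrier R. \<exists>n\<in>N. n \<oplus>\<^bsub>M\<^esub> r \<odot>\<^bsub>M\<^esub> s \<in> U} = {r \<in> carrier R. \<exists>n\<in>N. n \<oplus>\<^bsub>M\<^esub> r \<odot>\<^bsub>M\<^esub> s \<in> Y}"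
  have UD: "submodule U R M" and YD: "submodule Y R M" using U Y by auto
  note UD = submoduleD[OF UD] and YD = submoduleD[OF YD]
  show "Y \<subseteq> U"
  proof
    fix y assume y: "y \<in> Y"
    then obtain n r where nr: "y = n \<oplus>\<^bsub>M\<^esub> r \<odot>\<^bsub>M\<^esub> s" "n \<in> N" "r \<in> carrier R" using Y by blast
    then have "r \<in> {r \<in> carrier R. \<exists>n\<in>N. n \<oplus>\<^bsub>M\<^esub> r \<odot>\<^bsub>M\<^esub> s \<in> U}" unfolding g using y by blast
    then obtain m where m: "m \<in> N" "m \<oplus>\<^bsub>M\<^esub> r \<odot>\<^bsub>M\<^esub> s \<in> U" by blast
    \<comment> \<open>Both \<open>y\<close> and \<open>m + r s\<close> lie in \<open>Y\<close> and
      are congruent to \<open>r s\<close> modulo \<open>N\<close>. Their difference is in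
      \<open>N\<close> and in \<open>Y\<close>, where \<open>U\<close> and \<open>Y\<close>
      agree.\<close>
    have "n \<ominus>\<^bsub>M\<^esub> m = y \<ominus>\<^bsub>M\<^esub> (m \<oplus>\<^bsub>M\<^esub> r \<odot>\<^bsub>M\<^esub> s)"
      using nr m(1) s ND(1) by (simp add: a_minus_def M.minus_add M.a_ac M.r_neg M.r_neg1 M.r_neg2)
    then have "n \<ominus>\<^bsub>M\<^esub> m \<in> U"
      using f ND(5)[OF nr(2) m(1)] YD(5) y m(2) \<open>U \<subseteq> Y\<close> by (metis IntD1 IntI subsetD)
    then have "(n \<ominus>\<^bsub>M\<^esub> m) \<oplus>\<^bsub>M\<^esub> (m \<oplus>\<^bsub>M\<^esub> r \<odot>\<^bsub>M\<^esub> s) \<in> U" using UD(4) m by blast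
    moreover have "(n \<ominus>\<^bsub>M\<^esub> m) \<oplus>\<^bsub>M\<^esub> (m \<oplus>\<^bsub>M\<^esub> r \<odot>\<^bsub>M\<^esub> s) = y"
      using nr m(1) s ND(1) by (simp add: a_minus_def M.a_assoc M.r_neg1)
    ultimately show "y \<in> U" by simp
  qed
qed (use N s in \<open>auto intro: submodule_Int ideal_relative_colon\<close>)

lemma submodule_finsum:
  assumes "submodule N R M" "finite S" "\<And>x. x \<in> S \<Longrightarrow> f x \<in> N"
  shows "(\<Oplus>\<^bsub>M\<^esub>x\<in>S. f x) \<in> N"
  using assms(2,3)
proof (induction S rule: finite_induct)
  case empty
  then show ?case using submoduleD[OF assms(1)] by simp
next
  case (insert a S)
  moreover have "f \<in> insert a S \<rightarrow> carrier M"
    using insert submoduleD(1)[OF assms(1)] by auto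
  ultimately show ?case using submoduleD(4)[OF assms(1)] by (simp add: Pi_def)
qed

text \<open>The generators are adjoined one at a time, starting from the zero submodule, which has
  only finitely many submodules.\<close>

lemma finitely_generated_dcc:
  assumes "dcc_on {I. ideal I R}"
    and S: "finite S" "S \<subseteq> carrier M"
    and gen: "\<And>x. x \<in> carrier M \<Longrightarrow> \<exists>c \<in> S \<rightarrow> carrier R. x = (\<Oplus>\<^bsub>M\<^esub>s\<in>S. c s \<odot>\<^bsub>M\<^esub> s)"
  shows "dcc_on {U. submodule U R M}"
proof -
  have "\<exists>N. submodule N R M \<and> S \<subseteq> N \<and> dcc_on (submods N)"
    using S
  proof (induction S rule: finite_induct)
    case empty
    have "submodule {\<zero>\<^bsub>M\<^esub>} R M" by (rule submoduleI') auto
    moreover have "dcc_on (submods {\<zero>\<^bsub>M\<^esub>})"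
      by (rule finite_imp_dcc_on, rule finite_subset[of _ "Pow {\<zero>\<^bsub>M\<^esub>}"]) auto
    ultimately show ?case by blast
  next
    case (insert s S)
    then obtain N where N: "submodule N R M" "S \<subseteq> N" "dcc_on (submods N)" by auto
    have s: "s \<in> carrier M" using insert by simp
    show ?case
      using dcc_add_cyclic[OF assms(1) N(1,3) s] submodule_add_cyclic[OF N(1) s] N(2)
      by (meson insert_subset order_trans)
  qed
  then obtain N where N: "submodule N R M" "S \<subseteq> N" "dcc_on (submods N)" by blast
  have "carrier M \<subseteq> N"
  proof
    fix x assume "x \<in> carrier M"
    then obtain c where "c \<in> S \<rightarrow> carrier R" "x = (\<Oplus>\<^bsub>M\<^esub>s\<in>S. c s \<odot>\<^bsub>M\<^esub> s)" using gen by blast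
    then show "x \<in> N"
      using N(2) submoduleD(6)[OF N(1)] by (auto intro!: submodule_finsum[OF N(1) S(1)])
  qed
  then show ?thesis
    using submoduleD(1) by (intro dcc_on_subset[OF N(3)]) blast
qed

text \<open>Multiplication by a scalar is an endomorphism because the ring is commutative; its image
  and its kernel are the two pieces into which a minimal non-noetherian submodule will be
  split.\<close>

lemma submodule_image_smult:
  assumes "submodule N R M" "r \<in> carrier R"
  shows "submodule ((\<odot>\<^bsub>M\<^esub>) r ` N) R M"
proof -
  note ND = submoduleD[OF assms(1)]
  show ?thesis
  proof (rule submoduleI')
    show "\<zero>\<^bsub>M\<^esub> \<in> (\<odot>\<^bsub>M\<^esub>) r ` N"
      using ND(2) assms(2) by (metis imageI smult_r_null)
    show "a \<oplus>\<^bsub>M\<^esub> b \<in> (\<odot>\<^bsub>M\<^esub>) r ` N" if "a \<in> (\<odot>\<^bsub>M\<^esub>) r ` N" "b \<in> (\<odot>\<^bsub>M\<^esub>) r ` N" for a b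
      using that ND(1,4) assms(2) by (auto simp flip: smult_r_distr)
    show "a \<odot>\<^bsub>M\<^esub> x \<in> (\<odot>\<^bsub>M\<^esub>) r ` N" if "a \<in> carrier R" "x \<in> (\<odot>\<^bsub>M\<^esub>) r ` N" for a x
      using that ND(1,6) assms(2) by (auto simp flip: smult_assoc1 simp: R.m_comm)
        (metis (no_types, lifting) R.m_comm image_iff smult_assoc1)
  qed (use ND(1) assms(2) in auto)
qed

lemma submodule_smult_kernel:
  assumes "submodule N R M" "r \<in> carrier R"
  shows "submodule {x \<in> N. r \<odot>\<^bsub>M\<^esub> x = \<zero>\<^bsub>M\<^esub>} R M"
proof -
  note ND = submoduleD[OF assms(1)]
  show ?thesis
  proof (rule submoduleI')
    show "a \<odot>\<^bsub>M\<^esub> x \<in> {x \<in> N. r \<odot>\<^bsub>M\<^esub> x = \<zero>\<^bsub>M\<^esub>}"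
      if "a \<in> carrier R" "x \<in> {x \<in> N. r \<odot>\<^bsub>M\<^esub> x = \<zero>\<^bsub>M\<^esub>}" for a x
    proof -
      have "r \<odot>\<^bsub>M\<^esub> (a \<odot>\<^bsub>M\<^esub> x) = a \<odot>\<^bsub>M\<^esub> (r \<odot>\<^bsub>M\<^esub> x)"
        using that ND(1) assms(2) by (metis (no_types, lifting) R.m_comm mem_Collect_eq smult_assoc1)
      then show ?thesis using that ND(6) by simp
    qed
  qed (use ND assms(2) in \<open>auto simp: smult_r_distr\<close>)
qed

text \<open>\<open>N\<close> is an extension of \<open>r N\<close> by the kernel of multiplication
  by \<open>r\<close>: elements of \<open>U\<close> and \<open>Y\<close> with the same multiple by
  \<open>r\<close> differ by an element of the kernel.\<close>

lemma acc_kernel_image: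
  assumes N: "submodule N R M" and r: "r \<in> carrier R"
    and "acc_on (submods {x \<in> N. r \<odot>\<^bsub>M\<^esub> x = \<zero>\<^bsub>M\<^esub>})" "acc_on (submods ((\<odot>\<^bsub>M\<^esub>) r ` N))"
  shows "acc_on (submods N)"
proof (rule acc_on_lift[OF assms(3,4), where f="\<lambda>U. U \<inter> {x \<in> N. r \<odot>\<^bsub>M\<^esub> x = \<zero>\<^bsub>M\<^esub>}"
      and g="(`) ((\<odot>\<^bsub>M\<^esub>) r)"])
  note ND = submoduleD[OF N]
  fix U Y
  assume U: "U \<in> submods N" and Y: "Y \<in> submods N" and "U \<subseteq> Y"
    and f: "U \<inter> {x \<in> N. r \<odot>\<^bsub>M\<^esub> x = \<zero>\<^bsub>M\<^esub>} = Y \<inter> {x \<in> N. r \<odot>\<^bsub>M\<^esub> x = \<zero>\<^bsub>M\<^esub>}"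
    and g: "(\<odot>\<^bsub>M\<^esub>) r ` U = (\<odot>\<^bsub>M\<^esub>) r ` Y"
  have UD: "submodule U R M" and YD: "submodule Y R M" using U Y by auto
  note UD = submoduleD[OF UD] and YD = submoduleD[OF YD]
  show "Y \<subseteq> U"
  proof
    fix y assume y: "y \<in> Y"
    then obtain x where x: "x \<in> U" "r \<odot>\<^bsub>M\<^esub> y = r \<odot>\<^bsub>M\<^esub> x" using g by blast
    have c: "x \<in> carrier M" "y \<in> carrier M" using UD(1) YD(1) x y by auto
    have "r \<odot>\<^bsub>M\<^esub> (y \<ominus>\<^bsub>M\<^esub> x) = \<zero>\<^bsub>M\<^esub>"
      using x c r by (simp add: a_minus_def smult_r_distr smult_r_minus M.r_neg)
    moreover have "y \<ominus>\<^bsub>M\<^esub> x \<in> Y" using YD(5) x y \<open>U \<subseteq> Y\<close> by blast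
    ultimately have "y \<ominus>\<^bsub>M\<^esub> x \<in> U" using f Y by blast
    then have "(y \<ominus>\<^bsub>M\<^esub> x) \<oplus>\<^bsub>M\<^esub> x \<in> U" using UD(4) x by blast
    then show "y \<in> U" using c by (simp add: a_minus_def M.a_assoc M.l_neg)
  qed
qed (use N r in \<open>auto intro: submodule_Int submodule_image_smult submodule_smult_kernel\<close>)

text \<open>Zorn's lemma applies since a union of submodules avoiding \<open>x\<close> avoids
  \<open>x\<close>. The class of \<open>x\<close> then lies in every nonzero submodule of
  \<open>N/L\<close>; over a field this makes \<open>L\<close> a hyperplane of \<open>N\<close>
  complementing the line through \<open>x\<close>.\<close>

lemma ex_maximal_submodule_avoiding:
  assumes "submodule N R M" "x \<noteq> \<zero>\<^bsub>M\<^esub>"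
  obtains L where "submodule L R M" "L \<subseteq> N" "x \<notin> L"
    "\<And>U. submodule U R M \<Longrightarrow> U \<subseteq> N \<Longrightarrow> L \<subset> U \<Longrightarrow> x \<in> U"
proof -
  let ?F = "{U. submodule U R M \<and> U \<subseteq> N \<and> x \<notin> U}"
  have "{\<zero>\<^bsub>M\<^esub>} \<in> ?F"
  proof -
    have "submodule {\<zero>\<^bsub>M\<^esub>} R M" by (rule submoduleI') auto
    then show ?thesis using assms(2) submoduleD(2)[OF assms(1)] by simp
  qed
  then have "?F \<noteq> {}" by blast
  moreover have "\<Union>C \<in> ?F" if "C \<noteq> {}" and C: "subset.chain ?F C" for C
  proof -
    have mem: "submodule U R M" "U \<subseteq> N" "x \<notin> U" if "U \<in> C" for U
      using C that by (auto simp: subset.chain_def)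
    have "submodule (\<Union>C) R M"
    proof (rule submoduleI')
      show "\<Union>C \<subseteq> carrier M" using mem submoduleD(1) by blast
      show "\<zero>\<^bsub>M\<^esub> \<in> \<Union>C" using mem submoduleD(2) \<open>C \<noteq> {}\<close> by blast
      show "a \<oplus>\<^bsub>M\<^esub> b \<in> \<Union>C" if ab: "a \<in> \<Union>C" "b \<in> \<Union>C" for a b
      proof -
        obtain U Y where XY: "U \<in> C" "Y \<in> C" "a \<in> U" "b \<in> Y" using ab by blast
        then have "U \<subseteq> Y \<or> Y \<subseteq> U" using C by (auto simp: subset.chain_def)
        then show ?thesis using XY submoduleD(4) mem by (meson UnionI subsetD)
      qed
      show "a \<odot>\<^bsub>M\<^esub> y \<in> \<Union>C" if "a \<in> carrier R" "y \<in> \<Union>C" for a y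
        using that submoduleD(6) mem by blast
    qed
    then show ?thesis using mem by blast
  qed
  ultimately obtain L where "L \<in> ?F" "\<forall>U\<in>?F. L \<subseteq> U \<longrightarrow> U = L"
    using subset_Zorn_nonempty[of ?F] by blast
  then show thesis by (intro that[of L]) blast+
qed

text \<open>
  The module analogue of the Hopkins--Levitzki theorem over a commutative ring. A minimal
  non-noetherian submodule \<open>N\<close> satisfies \<open>r N = N\<close> or \<open>r N = 0\<close> for every scalar \<open>r\<close>, so its
  annihilator is prime, hence maximal, and \<open>N\<close> is a vector space all of whose proper subspaces
  are noetherian.
\<close>

theorem dcc_imp_acc:
  assumes R: "dcc_on {I. ideal I R}" and M: "dcc_on {U. submodule U R M}"
  shows "acc_on {U. submodule U R M}"
proof (rule ccontr)
  assume "\<not> acc_on {U. submodule U R M}"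
  moreover have "submods (carrier M) = {U. submodule U R M}"
    using submoduleD(1) by blast
  ultimately have "\<not> acc_on (submods (carrier M))" by simp
  then obtain N where N: "submodule N R M" and bad: "\<not> acc_on (submods N)"
    and minN: "\<And>U. submodule U R M \<Longrightarrow> U \<subset> N \<Longrightarrow> acc_on (submods U)"
    by - (rule dcc_onE_min[OF M, of "carrier M" "\<lambda>N. \<not> acc_on (submods N)"],
      use carrier_is_submodule in auto)
  note ND = submoduleD[OF N]
  define P where "P = {r \<in> carrier R. \<forall>x\<in>N. r \<odot>\<^bsub>M\<^esub> x = \<zero>\<^bsub>M\<^esub>}"
  \<comment> \<open>If \<open>r N\<close> and the kernel of \<open>r\<close> on \<open>N\<close>
    were both proper, minimality of \<open>N\<close> would make both noetherian, and hence
    \<open>N\<close> itself.\<close>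
  have rN: "(\<odot>\<^bsub>M\<^esub>) r ` N = N" if r: "r \<in> carrier R" "r \<notin> P" for r
  proof (rule ccontr)
    assume "(\<odot>\<^bsub>M\<^esub>) r ` N \<noteq> N"
    then have "(\<odot>\<^bsub>M\<^esub>) r ` N \<subset> N" using ND(6) r by blast
    moreover have "{x \<in> N. r \<odot>\<^bsub>M\<^esub> x = \<zero>\<^bsub>M\<^esub>} \<subset> N" using r by (auto simp: P_def)
    ultimately show False
      using bad acc_kernel_image[OF N r(1)] minN submodule_image_smult[OF N r(1)]
        submodule_smult_kernel[OF N r(1)] by blast
  qed
  have P: "ideal P R"
  proof (rule idealI)
    show "subgroup P (add_monoid R)"
    proof (rule group.subgroupI)
      show "group (add_monoid R)" by (rule R.a_group)
      have "\<zero> \<in> P" using ND(1) by (simp add: P_def)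
      then show "P \<noteq> {}" by blast
      show "inv\<^bsub>add_monoid R\<^esub> a \<in> P" if "a \<in> P" for a
        using that ND(1) by (auto simp: P_def smult_l_minus simp flip: a_inv_def)
    qed (use ND(1) in \<open>auto simp: P_def smult_l_distr\<close>)
    show *: "x \<otimes> a \<in> P" if "a \<in> P" "x \<in> carrier R" for a x
      using that ND(1) by (auto simp: P_def smult_assoc1)
    show "a \<otimes> x \<in> P" if "a \<in> P" "x \<in> carrier R" for a x
      using *[OF that] that by (simp add: R.m_comm P_def)
  qed (rule R.ring_axioms)
  have prime: "r \<otimes> s \<notin> P" if r: "r \<in> carrier R" "r \<notin> P" and s: "s \<in> carrier R" "s \<notin> P" for r s
  proof
    assume rs: "r \<otimes> s \<in> P"
    obtain x where x: "x \<in> N" "r \<odot>\<^bsub>M\<^esub> x \<noteq> \<zero>\<^bsub>M\<^esub>" using r by (auto simp: P_def)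
    then obtain y where y: "y \<in> N" "x = s \<odot>\<^bsub>M\<^esub> y" using rN[of s] s by blast
    then have "r \<odot>\<^bsub>M\<^esub> x = (r \<otimes> s) \<odot>\<^bsub>M\<^esub> y" using r s ND(1) by (simp add: smult_assoc1)
    then show False using rs x y by (auto simp: P_def)
  qed
  \<comment> \<open>This is the maximality of a prime ideal in an artinian ring. With
    \<open>Q\<close> minimal among the ideals strictly above \<open>P\<close> and \<open>q\<close>
    in \<open>Q\<close> but not in \<open>P\<close>, primeness puts \<open>P + (r q)\<close>
    strictly above \<open>P\<close>, so it is all of \<open>Q\<close> and contains \<open>q\<close>.
    From \<open>q = p + s r q\<close> follows that \<open>(1 - s r) q\<close> is in
    \<open>P\<close>, hence so is \<open>1 - s r\<close>, and \<open>s\<close> inverts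
    \<open>r\<close> on \<open>N\<close>.\<close>
  have inverse: "\<exists>s\<in>carrier R. \<forall>x\<in>N. s \<odot>\<^bsub>M\<^esub> (r \<odot>\<^bsub>M\<^esub> x) = x" if r: "r \<in> carrier R" "r \<notin> P" for r
  proof -
    have "P \<subset> carrier R" using r by (auto simp: P_def)
    then obtain Q where Q: "ideal Q R" "P \<subset> Q"
      and minQ: "\<And>I. ideal I R \<Longrightarrow> P \<subset> I \<Longrightarrow> \<not> I \<subset> Q"
      using dcc_onE_min[OF R, of "carrier R" "\<lambda>I. P \<subset> I"] R.oneideal
      by (metis (no_types, lifting) mem_Collect_eq)
    then obtain q where q: "q \<in> Q" "q \<notin> P" by blast
    have qR: "q \<in> carrier R" using q(1) ideal.Icarr[OF Q(1)] by blast
    have rqR: "r \<otimes> q \<in> carrier R" using r qR by simp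
    have gen: "ideal (PIdl (r \<otimes> q)) R" using rqR by (rule R.cgenideal_ideal)
    have sum: "ideal (P <+>\<^bsub>R\<^esub> PIdl (r \<otimes> q)) R" using P gen by (rule R.add_ideals)
    have "\<zero> \<in> PIdl (r \<otimes> q)" "\<zero> \<in> P"
      using gen P by (simp_all add: additive_subgroup.zero_closed ideal.axioms(1))
    moreover have "r \<otimes> q \<in> PIdl (r \<otimes> q)" using rqR by (rule R.cgenideal_self)
    ultimately have "P \<subseteq> P <+>\<^bsub>R\<^esub> PIdl (r \<otimes> q)" "r \<otimes> q \<in> P <+>\<^bsub>R\<^esub> PIdl (r \<otimes> q)"
      using rqR ideal.Icarr[OF P] unfolding set_add_def' by (force, force)
    then have "P \<subset> P <+>\<^bsub>R\<^esub> PIdl (r \<otimes> q)" using prime[OF r qR q(2)] by blast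
    moreover have "P <+>\<^bsub>R\<^esub> PIdl (r \<otimes> q) \<subseteq> Q"
    proof -
      have "r \<otimes> q \<in> Q" using q r ideal.I_l_closed[OF Q(1)] by blast
      then have "PIdl (r \<otimes> q) \<subseteq> Q" using Q(1) R.cgenideal_minimal by blast
      then show ?thesis
        using Q additive_subgroup.a_closed[OF ideal.axioms(1)[OF Q(1)]]
        unfolding set_add_def' by blast
    qed
    ultimately have "q \<in> P <+>\<^bsub>R\<^esub> PIdl (r \<otimes> q)" using minQ[OF sum] q(1) by blast
    then obtain p s where ps: "p \<in> P" "s \<in> carrier R" "q = p \<oplus> s \<otimes> (r \<otimes> q)"
      unfolding set_add_def' cgenideal_def by blast
    have pR: "p \<in> carrier R" using ps(1) by (simp add: P_def)
    have "p = (\<one> \<ominus> s \<otimes> r) \<otimes> q"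
    proof -
      have "q \<ominus> s \<otimes> (r \<otimes> q) = p"
        using ps pR qR r by (metis R.add.inv_solve_right R.m_closed a_minus_def)
      then show ?thesis
        using ps pR qR r by (simp add: a_minus_def R.l_distr R.l_minus R.m_assoc)
    qed
    then have inP: "\<one> \<ominus> s \<otimes> r \<in> P" using prime[of "\<one> \<ominus> s \<otimes> r" q] ps q qR r by auto
    have "s \<odot>\<^bsub>M\<^esub> (r \<odot>\<^bsub>M\<^esub> x) = x" if x: "x \<in> N" for x
    proof -
      have xM: "x \<in> carrier M" using ND(1) x by blast
      have "\<zero>\<^bsub>M\<^esub> = (\<one> \<ominus> s \<otimes> r) \<odot>\<^bsub>M\<^esub> x"
        using inP x by (simp add: P_def)
      also have "\<dots> = x \<ominus>\<^bsub>M\<^esub> (s \<odot>\<^bsub>M\<^esub> (r \<odot>\<^bsub>M\<^esub> x))"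
        using xM r(1) ps(2) by (simp add: a_minus_def smult_l_distr smult_l_minus smult_assoc1)
      finally have "\<zero>\<^bsub>M\<^esub> = x \<ominus>\<^bsub>M\<^esub> (s \<odot>\<^bsub>M\<^esub> (r \<odot>\<^bsub>M\<^esub> x))" .
      then have "\<zero>\<^bsub>M\<^esub> \<oplus>\<^bsub>M\<^esub> s \<odot>\<^bsub>M\<^esub> (r \<odot>\<^bsub>M\<^esub> x) = x \<ominus>\<^bsub>M\<^esub> (s \<odot>\<^bsub>M\<^esub> (r \<odot>\<^bsub>M\<^esub> x)) \<oplus>\<^bsub>M\<^esub> s \<odot>\<^bsub>M\<^esub> (r \<odot>\<^bsub>M\<^esub> x)"
        by simp
      then show ?thesis using xM r(1) ps(2) by (simp add: a_minus_def M.a_assoc M.l_neg)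
    qed
    then show ?thesis using ps(2) by blast
  qed
  have "N \<noteq> {\<zero>\<^bsub>M\<^esub>}"
  proof
    assume "N = {\<zero>\<^bsub>M\<^esub>}"
    then have "finite (submods N)" by (auto intro: finite_subset[of _ "Pow N"])
    then show False using bad finite_imp_acc_on by blast
  qed
  then obtain x where x: "x \<in> N" "x \<noteq> \<zero>\<^bsub>M\<^esub>" using ND(2) by blast
  have xM: "x \<in> carrier M" using ND(1) x by blast
  obtain L where L: "submodule L R M" "L \<subseteq> N" "x \<notin> L"
    and maxL: "\<And>U. submodule U R M \<Longrightarrow> U \<subseteq> N \<Longrightarrow> L \<subset> U \<Longrightarrow> x \<in> U"
    using ex_maximal_submodule_avoiding[OF N x(2)] by blast
  note LD = submoduleD[OF L(1)]
  \<comment> \<open>\<open>N/L\<close> is simple. If neither \<open>y\<close> nor \<open>z\<close>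
    is in \<open>L\<close>, then \<open>x\<close> lies in \<open>L + R y\<close> and in
    \<open>L + R z\<close>; the coefficient of \<open>z\<close> is not in \<open>P\<close>, as
    otherwise \<open>x\<close> would be in \<open>L\<close>, so it can be inverted on
    \<open>N\<close> and the equation solved for \<open>z\<close>.\<close>
  have mod_L: "\<exists>l\<in>L. \<exists>s\<in>carrier R. z = l \<oplus>\<^bsub>M\<^esub> s \<odot>\<^bsub>M\<^esub> y" if y: "y \<in> N" "y \<notin> L" and z: "z \<in> N" for y z
  proof -
    have key: "\<exists>l\<in>L. \<exists>s\<in>carrier R. x = l \<oplus>\<^bsub>M\<^esub> s \<odot>\<^bsub>M\<^esub> y" if y: "y \<in> N" "y \<notin> L" for y
    proof -
      have yM: "y \<in> carrier M" using ND(1) y by blast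
      let ?U = "{n \<oplus>\<^bsub>M\<^esub> r \<odot>\<^bsub>M\<^esub> y | n r. n \<in> L \<and> r \<in> carrier R}"
      have "?U \<subseteq> N" using L y ND(4,6) by blast
      then have "x \<in> ?U"
        using maxL[of ?U] submodule_add_cyclic[OF L(1) yM] y(2) by blast
      then show ?thesis by blast
    qed
    show ?thesis
    proof (cases "z \<in> L")
      case True
      have "z = z \<oplus>\<^bsub>M\<^esub> \<zero> \<odot>\<^bsub>M\<^esub> y" using ND(1) y z by simp
      then show ?thesis using True by blast
    next
      case False
      obtain l s where l: "l \<in> L" "s \<in> carrier R" "x = l \<oplus>\<^bsub>M\<^esub> s \<odot>\<^bsub>M\<^esub> z"
        using key[OF z False] by blast
      obtain k t where k: "k \<in> L" "t \<in> carrier R" "x = k \<oplus>\<^bsub>M\<^esub> t \<odot>\<^bsub>M\<^esub> y"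
        using key[OF y] by blast
      have zM: "z \<in> carrier M" "y \<in> carrier M" "l \<in> carrier M" "k \<in> carrier M"
        using ND(1) LD(1) y z l k by auto
      have "s \<notin> P"
      proof
        assume "s \<in> P"
        then have "x = l" using l zM z by (auto simp: P_def)
        then show False using l L(3) by simp
      qed
      then obtain u where u: "u \<in> carrier R" "u \<odot>\<^bsub>M\<^esub> (s \<odot>\<^bsub>M\<^esub> z) = z"
        using inverse[OF l(2)] z by blast
      have "s \<odot>\<^bsub>M\<^esub> z = x \<ominus>\<^bsub>M\<^esub> l"
        using l zM by (simp add: a_minus_def M.a_ac M.r_neg1 M.r_neg2)
      also have "\<dots> = (k \<ominus>\<^bsub>M\<^esub> l) \<oplus>\<^bsub>M\<^esub> t \<odot>\<^bsub>M\<^esub> y"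
        unfolding k(3) using k(2) zM by (simp add: a_minus_def M.a_ac)
      finally have "z = u \<odot>\<^bsub>M\<^esub> (k \<ominus>\<^bsub>M\<^esub> l) \<oplus>\<^bsub>M\<^esub> (u \<otimes> t) \<odot>\<^bsub>M\<^esub> y"
        using u k(2) zM by (metis M.minus_closed smult_assoc1 smult_closed smult_r_distr)
      then show ?thesis using u k(1,2) l(1) LD(5,6) R.m_closed by metis
    qed
  qed
  \<comment> \<open>Since \<open>N/L\<close> is simple, the image of \<open>U\<close> in it is known
    from whether \<open>U\<close> lies in \<open>L\<close>. The lifting lemma wants a set-valued
    invariant, so this truth value is encoded as a subset of \<open>unit\<close>.\<close>
  have fin: "acc_on (UNIV :: unit set set)" by (rule finite_imp_acc_on) simp
  have "acc_on (submods N)"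
  proof (rule acc_on_lift[OF minN[OF L(1)] fin, where f="\<lambda>U. U \<inter> L" and g="\<lambda>U. {_. \<not> U \<subseteq> L}"])
    show "L \<subset> N" using L x by blast
    fix U Y
    assume U: "U \<in> submods N" and Y: "Y \<in> submods N" and "U \<subseteq> Y" and f: "U \<inter> L = Y \<inter> L"
      and g: "{_ :: unit. \<not> U \<subseteq> L} = {_. \<not> Y \<subseteq> L}"
    have UD: "submodule U R M" and YD: "submodule Y R M" using U Y by auto
    note UD = submoduleD[OF UD] and YD = submoduleD[OF YD]
    show "Y \<subseteq> U"
    proof (cases "Y \<subseteq> L")
      case False
      then have "\<not> U \<subseteq> L" using g by auto
      then obtain y where y: "y \<in> U" "y \<notin> L" by blast
      show ?thesis
      proof
        fix z assume z: "z \<in> Y"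
        then obtain l s where l: "l \<in> L" "s \<in> carrier R" "z = l \<oplus>\<^bsub>M\<^esub> s \<odot>\<^bsub>M\<^esub> y"
          using mod_L[of y z] U Y y by blast
        have c: "l \<in> carrier M" "y \<in> carrier M" using LD(1) UD(1) l y by auto
        have "l = z \<ominus>\<^bsub>M\<^esub> s \<odot>\<^bsub>M\<^esub> y"
          using l c by (simp add: a_minus_def M.a_assoc M.r_neg)
        then have "l \<in> U" using YD(5)[OF z] YD(6)[OF l(2)] y \<open>U \<subseteq> Y\<close> f l by blast
        then show "z \<in> U" using l y UD(4,6) by blast
      qed
    qed (use f in blast)
  qed (use L in \<open>auto intro: submodule_Int\<close>)
  then show False using bad by simp
qed

end

section \<open>Annihilators of left ideals\<close>

lemma opp_simps [simp]:
  "carrier (opp R) = carrier R" "\<zero>\<^bsub>opp R\<^esub> = \<zero>\<^bsub>R\<^esub>" "\<one>\<^bsub>opp R\<^esub> = \<one>\<^bsub>R\<^esub>"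
  "x \<oplus>\<^bsub>opp R\<^esub> y = x \<oplus>\<^bsub>R\<^esub> y" "x \<otimes>\<^bsub>opp R\<^esub> y = y \<otimes>\<^bsub>R\<^esub> x"
  by (simp_all add: opp_def)

lemma (in ring) ring_opp: "ring (opp R)"
proof (rule ringI)
  show "abelian_group (opp R)"
  proof (rule abelian_groupI)
    fix x assume "x \<in> carrier (opp R)"
    then show "\<exists>y\<in>carrier (opp R). y \<oplus>\<^bsub>opp R\<^esub> x = \<zero>\<^bsub>opp R\<^esub>"
      by (intro bexI[of _ "\<ominus> x"]) (simp_all add: l_neg)
  qed (simp_all add: a_ac)
  show "monoid (opp R)"
    by (rule monoidI) (simp_all add: m_assoc)
qed (simp_all add: l_distr r_distr)

text \<open>Right ideals are the left ideals of \<open>opp R\<close>, so every result has its mirror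
  image by substitution. Closure under negation comes from multiplication by
  \<open>-1\<close>.\<close>

definition left_ideal :: "('a, 'b) ring_scheme \<Rightarrow> 'a set \<Rightarrow> bool" where
  "left_ideal R I \<longleftrightarrow> I \<subseteq> carrier R \<and> \<zero>\<^bsub>R\<^esub> \<in> I \<and> (\<forall>x\<in>I. \<forall>y\<in>I. x \<oplus>\<^bsub>R\<^esub> y \<in> I) \<and>
     (\<forall>a\<in>carrier R. \<forall>x\<in>I. a \<otimes>\<^bsub>R\<^esub> x \<in> I)"

definition maximal_left_ideal :: "('a, 'b) ring_scheme \<Rightarrow> 'a set \<Rightarrow> bool" where
  "maximal_left_ideal R I \<longleftrightarrow> left_ideal R I \<and> I \<noteq> carrier R \<and>
     (\<forall>J. left_ideal R J \<and> I \<subset> J \<longrightarrow> J = carrier R)"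

text \<open>In contrast to \<open>mod_hom\<close>, values outside \<open>I\<close> are left free, so
  that restricting to a smaller ideal keeps the same function.\<close>

definition left_linear :: "('a, 'b) ring_scheme \<Rightarrow> 'a set \<Rightarrow> ('a \<Rightarrow> 'a) \<Rightarrow> bool" where
  "left_linear R I f \<longleftrightarrow> (\<forall>x\<in>I. f x \<in> carrier R) \<and> (\<forall>x\<in>I. \<forall>y\<in>I. f (x \<oplus>\<^bsub>R\<^esub> y) = f x \<oplus>\<^bsub>R\<^esub> f y) \<and>
     (\<forall>a\<in>carrier R. \<forall>x\<in>I. f (a \<otimes>\<^bsub>R\<^esub> x) = a \<otimes>\<^bsub>R\<^esub> f x)"

text \<open>Over \<open>opp R\<close> this is the left annihilator;
  \<open>right_ann (opp R) (right_ann R I)\<close> is therefore the double annihilator of a left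
  ideal \<open>I\<close>.\<close>

definition right_ann :: "('a, 'b) ring_scheme \<Rightarrow> 'a set \<Rightarrow> 'a set" where
  "right_ann R I = {a \<in> carrier R. \<forall>x\<in>I. x \<otimes>\<^bsub>R\<^esub> a = \<zero>\<^bsub>R\<^esub>}"

text \<open>
  For a maximal left ideal \<open>I\<close>, the dual of the simple module \<open>R/I\<close> is \<open>right_ann R I\<close>. The two
  clauses say that the evaluation map of \<open>R/I\<close> is injective and surjective.
\<close>

definition simples_reflexive :: "('a, 'b) ring_scheme \<Rightarrow> bool" where
  "simples_reflexive R \<longleftrightarrow> (\<forall>I. maximal_left_ideal R I \<longrightarrow>
     (\<forall>x\<in>carrier R - I. \<exists>a\<in>right_ann R I. x \<otimes>\<^bsub>R\<^esub> a \<noteq> \<zero>\<^bsub>R\<^esub>) \<and>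
     (\<forall>f. left_linear (opp R) (right_ann R I) f \<longrightarrow>
        (\<exists>x\<in>carrier R. \<forall>a\<in>right_ann R I. f a = x \<otimes>\<^bsub>R\<^esub> a)))"

text \<open>The lattice form of the statement that \<open>I/J\<close> is a simple left
  module.\<close>

definition covers :: "('a, 'b) ring_scheme \<Rightarrow> 'a set \<Rightarrow> 'a set \<Rightarrow> bool" where
  "covers R J I \<longleftrightarrow> left_ideal R J \<and> left_ideal R I \<and> J \<subset> I \<and>
     (\<forall>V. left_ideal R V \<and> J \<subset> V \<and> V \<subseteq> I \<longrightarrow> V = I)"

section \<open>Simple factors in the lattice of left ideals\<close>

context ring
begin

lemma left_idealD:
  assumes "left_ideal R I"
  shows "\<And>x. x \<in> I \<Longrightarrow> x \<in> carrier R" and "\<zero> \<in> I"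
    and "\<And>x y. x \<in> I \<Longrightarrow> y \<in> I \<Longrightarrow> x \<oplus> y \<in> I"
    and "\<And>a x. a \<in> carrier R \<Longrightarrow> x \<in> I \<Longrightarrow> a \<otimes> x \<in> I"
    and "\<And>x. x \<in> I \<Longrightarrow> \<ominus> x \<in> I"
    and "\<And>x y. x \<in> I \<Longrightarrow> y \<in> I \<Longrightarrow> x \<ominus> y \<in> I"
proof -
  show 1: "x \<in> carrier R" if "x \<in> I" for x using assms that by (auto simp: left_ideal_def)
  show 2: "\<zero> \<in> I" "\<And>x y. x \<in> I \<Longrightarrow> y \<in> I \<Longrightarrow> x \<oplus> y \<in> I"
    "\<And>a x. a \<in> carrier R \<Longrightarrow> x \<in> I \<Longrightarrow> a \<otimes> x \<in> I"
    using assms by (auto simp: left_ideal_def)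
  show 3: "\<ominus> x \<in> I" if "x \<in> I" for x
  proof -
    have "\<ominus> x = (\<ominus> \<one>) \<otimes> x" using 1[OF that] by (simp add: l_minus)
    then show ?thesis using 2(3)[of "\<ominus> \<one>" x] that by simp
  qed
  show "x \<ominus> y \<in> I" if "x \<in> I" "y \<in> I" for x y
    using 2 3 that by (simp add: a_minus_def)
qed

lemma left_ideal_eq_carrier: "left_ideal R I \<Longrightarrow> \<one> \<in> I \<Longrightarrow> I = carrier R"
  using left_idealD(1) left_idealD(4)[of I _ \<one>] by force

lemma left_ideal_add_cyclic:
  assumes I: "left_ideal R I" and s: "s \<in> carrier R"
  shows "left_ideal R {i \<oplus> r \<otimes> s | i r. i \<in> I \<and> r \<in> carrier R}" (is "left_ideal R ?H")
    and "I \<subseteq> {i \<oplus> r \<otimes> s | i r. i \<in> I \<and> r \<in> carrier R}"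
    and "s \<in> {i \<oplus> r \<otimes> s | i r. i \<in> I \<and> r \<in> carrier R}"
proof -
  note ID = left_idealD[OF I]
  have "i = i \<oplus> \<zero> \<otimes> s" if "i \<in> I" for i using that s ID(1) by simp
  then show sub: "I \<subseteq> ?H" by blast
  have "s = \<zero> \<oplus> \<one> \<otimes> s" using s by simp
  then show "s \<in> ?H" using ID(2) by blast
  have "a \<oplus> b \<in> ?H" if a: "a \<in> ?H" and b: "b \<in> ?H" for a b
  proof -
    obtain i r where i: "i \<in> I" "r \<in> carrier R" "a = i \<oplus> r \<otimes> s" using a by blast
    obtain j t where j: "j \<in> I" "t \<in> carrier R" "b = j \<oplus> t \<otimes> s" using b by blast
    have "a \<oplus> b = (i \<oplus> j) \<oplus> (r \<oplus> t) \<otimes> s"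
      using i j s ID(1) by (simp add: l_distr a_ac)
    then show ?thesis using i j ID(3) by blast
  qed
  moreover have "a \<otimes> b \<in> ?H" if a: "a \<in> carrier R" and b: "b \<in> ?H" for a b
  proof -
    obtain j t where j: "j \<in> I" "t \<in> carrier R" "b = j \<oplus> t \<otimes> s" using b by blast
    have "a \<otimes> b = a \<otimes> j \<oplus> (a \<otimes> t) \<otimes> s"
      using a j s ID(1) by (simp add: r_distr m_assoc)
    then show ?thesis using a j ID(4) by blast
  qed
  moreover have "?H \<subseteq> carrier R" using s ID(1) by auto
  moreover have "\<zero> \<in> ?H" using sub ID(2) by blast
  ultimately show "left_ideal R ?H" unfolding left_ideal_def by blast
qed

lemma left_ideal_colon:
  assumes "left_ideal R I" "s \<in> carrier R"
  shows "left_ideal R {b \<in> carrier R. b \<otimes> s \<in> I}"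
  using left_idealD[OF assms(1)] assms(2) by (simp add: left_ideal_def l_distr m_assoc)

text \<open>The simple module \<open>I/J\<close> is generated by each of its nonzero
  classes.\<close>

lemma covers_eq_add_cyclic:
  assumes c: "covers R J I" and x: "x \<in> I" "x \<notin> J"
  shows "I = {i \<oplus> r \<otimes> x | i r. i \<in> J \<and> r \<in> carrier R}"
proof -
  have J: "left_ideal R J" and I: "left_ideal R I" and "J \<subset> I" using c by (auto simp: covers_def)
  note ID = left_idealD[OF I]
  have "{i \<oplus> r \<otimes> x | i r. i \<in> J \<and> r \<in> carrier R} \<subseteq> I"
    using \<open>J \<subset> I\<close> ID(3,4) x by blast
  moreover note left_ideal_add_cyclic[OF J ID(1)[OF x(1)]]
  ultimately show ?thesis using c x(2) unfolding covers_def by (metis (lifting) psubsetI)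
qed

text \<open>The set is the annihilator of the class of \<open>x\<close> in the simple module
  \<open>I/J\<close>, so that \<open>R/L\<close> is isomorphic to \<open>I/J\<close>. An element
  \<open>d\<close> outside it moves \<open>x\<close> to another generator, and
  \<open>x = j + r d x\<close> puts \<open>1 - r d\<close> into the annihilator.\<close>

lemma covers_colon_maximal:
  assumes c: "covers R J I" and x: "x \<in> I" "x \<notin> J"
  shows "maximal_left_ideal R {b \<in> carrier R. b \<otimes> x \<in> J}" (is "maximal_left_ideal R ?L")
proof -
  have J: "left_ideal R J" and I: "left_ideal R I" and "J \<subset> I" using c by (auto simp: covers_def)
  note ID = left_idealD[OF I] and JD = left_idealD[OF J]
  have xR: "x \<in> carrier R" using ID(1) x by blast
  have "V = carrier R" if V: "left_ideal R V" "?L \<subset> V" for V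
  proof -
    note VD = left_idealD[OF V(1)]
    obtain d where d: "d \<in> V" "d \<notin> ?L" using V by blast
    have dR: "d \<in> carrier R" using VD(1) d by blast
    have "d \<otimes> x \<in> I" "d \<otimes> x \<notin> J" using d dR ID(4) x by auto
    then obtain j r where jr: "j \<in> J" "r \<in> carrier R" "x = j \<oplus> r \<otimes> (d \<otimes> x)"
      using covers_eq_add_cyclic[OF c] x(1) by blast
    have jR: "j \<in> carrier R" using JD(1) jr by blast
    have "x \<ominus> r \<otimes> (d \<otimes> x) = j"
      using jr(2) jR dR xR by (subst jr(3)) (simp add: a_minus_def a_assoc r_neg)
    then have "(\<one> \<ominus> r \<otimes> d) \<otimes> x \<in> J"
      using jr(1,2) dR xR by (simp add: a_minus_def l_distr l_minus m_assoc)
    then have "\<one> \<ominus> r \<otimes> d \<in> ?L" using jr(2) dR by simp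
    then have "\<one> \<ominus> r \<otimes> d \<in> V" using V(2) by blast
    then have "(\<one> \<ominus> r \<otimes> d) \<oplus> r \<otimes> d \<in> V" using VD(3,4) jr(2) d(1) by blast
    then have "\<one> \<in> V" using jr(2) dR by (simp add: a_minus_def a_assoc l_neg)
    then show ?thesis using left_ideal_eq_carrier V(1) by blast
  qed
  moreover have "\<one> \<notin> ?L" using x xR by simp
  then have "?L \<noteq> carrier R" using one_closed by metis
  ultimately show ?thesis
    using left_ideal_colon[OF J xR] unfolding maximal_left_ideal_def by simp
qed

lemma left_ideal_right_ann_opp:
  assumes "I \<subseteq> carrier R"
  shows "left_ideal R (right_ann (opp R) I)"
  using assms by (auto simp: left_ideal_def right_ann_def l_distr m_assoc subset_eq)

lemma left_ideal_mult_right: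
  assumes J: "left_ideal R J" and x: "x \<in> carrier R"
  shows "left_ideal R ((\<lambda>a. a \<otimes> x) ` J)"
proof -
  note JD = left_idealD[OF J]
  show ?thesis
    unfolding left_ideal_def
  proof (intro conjI ballI)
    show "(\<lambda>a. a \<otimes> x) ` J \<subseteq> carrier R" using JD(1) x by auto
    have "\<zero> = \<zero> \<otimes> x" using x by simp
    then show "\<zero> \<in> (\<lambda>a. a \<otimes> x) ` J" using JD(2) by (rule image_eqI)
    fix b assume "b \<in> (\<lambda>a. a \<otimes> x) ` J"
    then obtain a where a: "a \<in> J" "b = a \<otimes> x" by blast
    show "b \<oplus> d \<in> (\<lambda>a. a \<otimes> x) ` J" if d: "d \<in> (\<lambda>a. a \<otimes> x) ` J" for d
    proof -
      obtain c where c: "c \<in> J" "d = c \<otimes> x" using d by blast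
      have "b \<oplus> d = (a \<oplus> c) \<otimes> x" using a c x JD(1) by (simp add: l_distr)
      then show ?thesis using JD(3)[OF a(1) c(1)] by (rule image_eqI)
    qed
    show "c \<otimes> b \<in> (\<lambda>a. a \<otimes> x) ` J" if c: "c \<in> carrier R" for c
    proof -
      have "c \<otimes> b = (c \<otimes> a) \<otimes> x" using a c x JD(1) by (simp add: m_assoc)
      then show ?thesis using JD(4)[OF c a(1)] by (rule image_eqI)
    qed
  qed
qed

lemma maximal_left_ideal_sum_one:
  assumes I: "maximal_left_ideal R I" and x: "x \<in> carrier R" "x \<notin> I"
  obtains i r where "i \<in> I" "r \<in> carrier R" "\<one> = i \<oplus> r \<otimes> x"
proof -
  have "left_ideal R I" using I by (simp add: maximal_left_ideal_def)
  then have "{i \<oplus> r \<otimes> x | i r. i \<in> I \<and> r \<in> carrier R} = carrier R"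
    using I left_ideal_add_cyclic[OF \<open>left_ideal R I\<close> x(1)] x(2)
    unfolding maximal_left_ideal_def by (metis (no_types, lifting) psubsetI)
  then have "\<one> \<in> {i \<oplus> r \<otimes> x | i r. i \<in> I \<and> r \<in> carrier R}" by simp
  then show thesis using that by blast
qed

lemma ex_covers_above:
  assumes "acc_on {I. left_ideal R I}" "left_ideal R T" "left_ideal R W" "T \<subset> W"
  obtains J where "T \<subseteq> J" "covers R J W"
proof (rule acc_onE_max[OF assms(1), of T "\<lambda>V. T \<subseteq> V \<and> V \<subset> W"])
  show "T \<in> {I. left_ideal R I}" "T \<subseteq> T \<and> T \<subset> W" using assms by simp_all
  fix J assume J: "J \<in> {I. left_ideal R I}" "T \<subseteq> J \<and> J \<subset> W"
    and max: "\<And>V. V \<in> {I. left_ideal R I} \<Longrightarrow> J \<subset> V \<Longrightarrow> \<not> (T \<subseteq> V \<and> V \<subset> W)"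
  have "V = W" if V: "left_ideal R V" "J \<subset> V" "V \<subseteq> W" for V
  proof (rule ccontr)
    assume "V \<noteq> W"
    then have "T \<subseteq> V \<and> V \<subset> W" using V J(2) by blast
    then show False using max[of V] V by simp
  qed
  then have "covers R J W" unfolding covers_def using J assms(3) by simp
  then show thesis using that[of J] J(2) by simp
qed

text \<open>
  If \<open>T\<close> is a maximal proper left ideal below \<open>W = {a. a I = 0}\<close>, then \<open>W/T\<close> embeds into \<open>R\<close>, and
  the resulting map \<open>W \<rightarrow> R\<close> is right multiplication by some \<open>x \<notin> I\<close>; as \<open>I + x R = R\<close>, its
  kernel \<open>T\<close> vanishes.
\<close>

lemma right_ann_opp_minimal:
  assumes acc: "acc_on {I. left_ideal R I}"
    and refl: "simples_reflexive R" "simples_reflexive (opp R)"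
    and I: "maximal_left_ideal (opp R) I"
    and T: "left_ideal R T" "T \<subset> right_ann (opp R) I"
  shows "T = {\<zero>}"
proof -
  interpret opp: ring "opp R" by (rule ring_opp)
  define W where "W = right_ann (opp R) I"
  have Isub: "I \<subseteq> carrier R" using I by (auto simp: maximal_left_ideal_def left_ideal_def)
  have W: "left_ideal R W" unfolding W_def by (rule left_ideal_right_ann_opp[OF Isub])
  have WI: "w \<otimes> i = \<zero>" if "w \<in> W" "i \<in> I" for w i
    using that by (simp add: W_def right_ann_def)
  obtain J where J: "T \<subseteq> J" "covers R J W"
    by (rule ex_covers_above[OF acc T(1) W T(2)[folded W_def]])
  have Jl: "left_ideal R J" using J by (simp add: covers_def)
  note WD = left_idealD[OF W] and JD = left_idealD[OF Jl]
  obtain a where a: "a \<in> W" "a \<notin> J" using J(2) by (auto simp: covers_def)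
  have aR: "a \<in> carrier R" using WD(1) a by blast
  \<comment> \<open>The class of \<open>a\<close> identifies \<open>W/J\<close> with
    \<open>R/L\<close>.\<close>
  define L where "L = {b \<in> carrier R. b \<otimes> a \<in> J}"
  have L: "maximal_left_ideal R L"
    unfolding L_def by (rule covers_colon_maximal[OF J(2) a])
  have "\<one> \<in> carrier R - L" using a aR by (simp add: L_def)
  \<comment> \<open>Injectivity of evaluation on \<open>R/L\<close> separates the class of the unit
    from zero. As \<open>L u = 0\<close> and \<open>u\<close> is nonzero, sending \<open>b\<close>
    to \<open>b u\<close> embeds the simple module \<open>R/L\<close> into \<open>R\<close>.\<close>
  then obtain u where u: "u \<in> right_ann R L" "\<one> \<otimes> u \<noteq> \<zero>"
    using refl(1) L unfolding simples_reflexive_def by meson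
  have uR: "u \<in> carrier R" and uL: "\<And>b. b \<in> L \<Longrightarrow> b \<otimes> u = \<zero>"
    using u by (auto simp: right_ann_def)
  have Weq: "W = {j \<oplus> b \<otimes> a | j b. j \<in> J \<and> b \<in> carrier R}"
    by (rule covers_eq_add_cyclic[OF J(2) a])
  \<comment> \<open>The composite of \<open>W -> W/J\<close>, the identification with
    \<open>R/L\<close> and the embedding given by \<open>u\<close>. It does not depend on the
    representation of \<open>w\<close>: two coefficients of \<open>a\<close> differ by an element of
    \<open>L\<close>, which \<open>u\<close> annihilates.\<close>
  define f where "f w = (THE v. \<exists>j b. j \<in> J \<and> b \<in> carrier R \<and> w = j \<oplus> b \<otimes> a \<and> v = b \<otimes> u)" for w
  have f: "f (j \<oplus> b \<otimes> a) = b \<otimes> u" if jb: "j \<in> J" "b \<in> carrier R" for j b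
    unfolding f_def
  proof (rule the_equality)
    show "\<exists>j' b'. j' \<in> J \<and> b' \<in> carrier R \<and> j \<oplus> b \<otimes> a = j' \<oplus> b' \<otimes> a \<and> b \<otimes> u = b' \<otimes> u"
      using jb by blast
    fix v assume "\<exists>j' b'. j' \<in> J \<and> b' \<in> carrier R \<and> j \<oplus> b \<otimes> a = j' \<oplus> b' \<otimes> a \<and> v = b' \<otimes> u"
    then obtain j' b' where *: "j' \<in> J" "b' \<in> carrier R" "j \<oplus> b \<otimes> a = j' \<oplus> b' \<otimes> a" "v = b' \<otimes> u"
      by blast
    have jR: "j \<in> carrier R" "j' \<in> carrier R" using JD(1) jb * by auto
    have "(b' \<ominus> b) \<otimes> a = b' \<otimes> a \<ominus> b \<otimes> a"
      using * jb aR by (simp add: a_minus_def l_distr l_minus)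
    also have "\<dots> = (\<ominus> j' \<oplus> (j' \<oplus> b' \<otimes> a)) \<ominus> b \<otimes> a"
      using * aR jR by (simp add: r_neg1)
    also have "\<dots> = (\<ominus> j' \<oplus> (j \<oplus> b \<otimes> a)) \<ominus> b \<otimes> a" using *(3) by simp
    also have "\<dots> = j \<ominus> j'"
      using jb(2) aR jR by (simp add: a_minus_def a_ac r_neg)
    finally have "(b' \<ominus> b) \<otimes> a \<in> J" using JD(6) jb * by simp
    then have "b' \<ominus> b \<in> L" using jb * by (simp add: L_def)
    then have "(b' \<ominus> b) \<otimes> u = \<zero>" by (rule uL)
    then have "(b' \<ominus> b) \<otimes> u \<oplus> b \<otimes> u = b \<otimes> u" using jb uR by simp
    then show "v = b \<otimes> u"
      using * jb uR by (simp add: a_minus_def l_distr l_minus a_assoc l_neg)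
  qed
  have lin: "left_linear R W f"
    unfolding left_linear_def
  proof (intro conjI ballI)
    fix w assume "w \<in> W"
    then obtain j b where w: "j \<in> J" "b \<in> carrier R" "w = j \<oplus> b \<otimes> a" using Weq by blast
    have jR: "j \<in> carrier R" using JD(1) w by blast
    show "f w \<in> carrier R" using w f uR by simp
    show "f (c \<otimes> w) = c \<otimes> f w" if c: "c \<in> carrier R" for c
    proof -
      have "c \<otimes> w = c \<otimes> j \<oplus> (c \<otimes> b) \<otimes> a" using w c aR jR by (simp add: r_distr m_assoc)
      then show ?thesis using f[of "c \<otimes> j" "c \<otimes> b"] f w c uR JD(4) by (simp add: m_assoc)
    qed
    show "f (w \<oplus> v) = f w \<oplus> f v" if "v \<in> W" for v
    proof -
      obtain k d where v: "k \<in> J" "d \<in> carrier R" "v = k \<oplus> d \<otimes> a" using Weq \<open>v \<in> W\<close> by blast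
      have kR: "k \<in> carrier R" using JD(1) v by blast
      have "w \<oplus> v = (j \<oplus> k) \<oplus> (b \<oplus> d) \<otimes> a"
        using w v aR jR kR by (simp add: l_distr a_ac)
      then show ?thesis using f[of "j \<oplus> k" "b \<oplus> d"] f w v uR JD(3) by (simp add: l_distr)
    qed
  qed
  \<comment> \<open>Now the other side: \<open>W\<close> is the dual of the simple right module
    \<open>R/I\<close>, so \<open>f\<close> is an element of the bidual and comes from some
    \<open>x\<close> by surjectivity of evaluation.\<close>
  have "left_linear (opp (opp R)) (right_ann (opp R) I) f"
    using lin by (simp add: W_def)
  then obtain x where x: "x \<in> carrier R" "\<And>w. w \<in> W \<Longrightarrow> f w = w \<otimes> x"
    using refl(2) I unfolding simples_reflexive_def W_def by force
  have "f a = u" using f[of \<zero> \<one>] JD(2) aR uR by simp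
  then have "a \<otimes> x \<noteq> \<zero>" using x(2)[OF a(1)] u(2) uR by simp
  then have "x \<notin> I" using WI a(1) by blast
  then obtain i r where ir: "i \<in> I" "r \<in> carrier R" "\<one> = i \<oplus> x \<otimes> r"
    using opp.maximal_left_ideal_sum_one[OF I, of x] x(1) by auto
  have iR: "i \<in> carrier R" using Isub ir by blast
  \<comment> \<open>The element \<open>t\<close> is annihilated by \<open>I\<close>, being in
    \<open>W\<close>, and by \<open>x\<close>, being in the kernel \<open>J\<close> of
    \<open>f\<close>; hence it is annihilated by \<open>1 = i + x r\<close>.\<close>
  have "t = \<zero>" if t: "t \<in> T" for t
  proof -
    have tJ: "t \<in> J" using t J by blast
    have tW: "t \<in> W" and tR: "t \<in> carrier R" using t T(2) W_def WD(1) by auto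
    have "f t = \<zero>" using f[OF tJ, of \<zero>] tR aR uR by simp
    then have "t \<otimes> x = \<zero>" using x(2)[OF tW] by simp
    then have "t \<otimes> (i \<oplus> x \<otimes> r) = \<zero>"
      using WI[OF tW ir(1)] tR iR ir(2) x(1) by (simp add: r_distr flip: m_assoc)
    then have "t \<otimes> \<one> = \<zero>" unfolding ir(3) .
    then show "t = \<zero>" using tR by simp
  qed
  then show ?thesis using left_idealD(2)[OF T(1)] by blast
qed

end

section \<open>Double annihilators and extension of linear maps\<close>

locale simples_reflexive_ring = ring +
  assumes acc: "acc_on {I. left_ideal R I}" "acc_on {I. left_ideal (opp R) I}"
    and dcc: "dcc_on {I. left_ideal R I}" "dcc_on {I. left_ideal (opp R) I}"
    and refl: "simples_reflexive R" "simples_reflexive (opp R)"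
begin

text \<open>The symmetry of the hypotheses allows the results on left ideals to be used for right
  ideals as well; the double annihilator needs them once on each side.\<close>

lemma simples_reflexive_ring_opp: "simples_reflexive_ring (opp R)"
  unfolding simples_reflexive_ring_def simples_reflexive_ring_axioms_def
  using ring_opp acc dcc refl by simp

lemma left_ideal_opp_right_ann: "I \<subseteq> carrier R \<Longrightarrow> left_ideal (opp R) (right_ann R I)"
  using ring.left_ideal_right_ann_opp[OF ring_opp] by simp

text \<open>The dual of the simple module \<open>R/I\<close> is simple: the minimality lemma, read
  in \<open>opp R\<close> and in contrapositive form.\<close>

lemma right_ann_minimal:
  assumes "maximal_left_ideal R I" "left_ideal (opp R) T" "T \<subseteq> right_ann R I" "T \<noteq> {\<zero>}"
  shows "T = right_ann R I"
  using ring.right_ann_opp_minimal[OF ring_opp, of I T] assms acc refl by auto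

lemma right_ann_antimono: "J \<subseteq> I \<Longrightarrow> right_ann R I \<subseteq> right_ann R J"
  by (auto simp: right_ann_def)

text \<open>Left multiplication by \<open>x\<close> maps \<open>right_ann R J\<close> into the
  annihilator on the right, which is the dual of \<open>I/J\<close>. Since
  \<open>I = J + R x\<close>, its kernel is \<open>right_ann R I\<close>, so the image of
  \<open>V\<close> is nonzero; the target being a minimal right ideal, the image is
  everything.\<close>

lemma mult_right_ideal_eq:
  assumes c: "covers R J I" and x: "x \<in> I" "x \<notin> J"
    and V: "left_ideal (opp R) V" "V \<subseteq> right_ann R J" and ne: "\<not> V \<subseteq> right_ann R I"
  shows "(\<otimes>) x ` V = right_ann R {b \<in> carrier R. b \<otimes> x \<in> J}"
proof (rule right_ann_minimal)
  interpret opp: ring "opp R" by (rule ring_opp)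
  have J: "left_ideal R J" and I: "left_ideal R I" and "J \<subset> I" using c by (auto simp: covers_def)
  note ID = left_idealD[OF I] and JD = left_idealD[OF J]
  have xR: "x \<in> carrier R" using ID(1) x by blast
  show "maximal_left_ideal R {b \<in> carrier R. b \<otimes> x \<in> J}" by (rule covers_colon_maximal[OF c x])
  show "left_ideal (opp R) ((\<otimes>) x ` V)" using opp.left_ideal_mult_right[OF V(1), of x] xR by simp
  show "(\<otimes>) x ` V \<subseteq> right_ann R {b \<in> carrier R. b \<otimes> x \<in> J}"
  proof
    fix y assume "y \<in> (\<otimes>) x ` V"
    then obtain v where v: "v \<in> V" "y = x \<otimes> v" by blast
    have vR: "v \<in> carrier R" and vJ: "\<And>j. j \<in> J \<Longrightarrow> j \<otimes> v = \<zero>"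
      using v V by (auto simp: right_ann_def)
    have "b \<otimes> y = \<zero>" if "b \<in> carrier R" "b \<otimes> x \<in> J" for b
      using vJ[OF that(2)] that v(2) vR xR by (simp add: m_assoc)
    then show "y \<in> right_ann R {b \<in> carrier R. b \<otimes> x \<in> J}"
      using v vR xR by (simp add: right_ann_def)
  qed
  show "(\<otimes>) x ` V \<noteq> {\<zero>}"
  proof
    assume 0: "(\<otimes>) x ` V = {\<zero>}"
    have "V \<subseteq> right_ann R I"
    proof
      fix v assume v: "v \<in> V"
      have vR: "v \<in> carrier R" and vJ: "\<And>j. j \<in> J \<Longrightarrow> j \<otimes> v = \<zero>"
        using v V by (auto simp: right_ann_def)
      have xv: "x \<otimes> v = \<zero>" using 0 v by blast
      have "i \<otimes> v = \<zero>" if i: "i \<in> I" for i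
      proof -
        obtain j r where jr: "j \<in> J" "r \<in> carrier R" "i = j \<oplus> r \<otimes> x"
          using covers_eq_add_cyclic[OF c x] i by blast
        then show ?thesis using vJ xv vR xR JD(1) by (simp add: l_distr m_assoc)
      qed
      then show "v \<in> right_ann R I" using vR by (simp add: right_ann_def)
    qed
    then show False using ne by simp
  qed
qed

text \<open>An intermediate \<open>V\<close> has the same image under multiplication by
  \<open>x\<close> as \<open>right_ann R J\<close>. Each \<open>a\<close> in the latter thus differs
  from an element of \<open>V\<close> by one that annihilates both \<open>J\<close> and
  \<open>x\<close>, hence \<open>I\<close>, and \<open>right_ann R I\<close> is contained in
  \<open>V\<close>.\<close>

lemma covers_right_ann:
  assumes c: "covers R J I" and ne: "right_ann R J \<noteq> right_ann R I"
  shows "covers (opp R) (right_ann R I) (right_ann R J)"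
proof -
  interpret opp: ring "opp R" by (rule ring_opp)
  have J: "left_ideal R J" and I: "left_ideal R I" and "J \<subset> I" using c by (auto simp: covers_def)
  note ID = left_idealD[OF I] and JD = left_idealD[OF J]
  obtain x where x: "x \<in> I" "x \<notin> J" using \<open>J \<subset> I\<close> by blast
  have xR: "x \<in> carrier R" using ID(1) x by blast
  have sub: "right_ann R I \<subseteq> right_ann R J" using right_ann_antimono \<open>J \<subset> I\<close> by blast
  have annI: "left_ideal (opp R) (right_ann R I)" and annJ: "left_ideal (opp R) (right_ann R J)"
    using left_ideal_opp_right_ann ID(1) JD(1) by blast+
  have "right_ann R J \<subseteq> V"
    if V: "left_ideal (opp R) V" "right_ann R I \<subset> V" "V \<subseteq> right_ann R J" for V
  proof
    fix a assume a: "a \<in> right_ann R J"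
    note VD = opp.left_idealD[OF V(1)]
    have "(\<otimes>) x ` V = (\<otimes>) x ` right_ann R J"
      using mult_right_ideal_eq[OF c x V(1,3)] mult_right_ideal_eq[OF c x annJ] V(2,3) by blast
    then obtain v where v: "v \<in> V" "x \<otimes> a = x \<otimes> v" using a by blast
    have aR: "a \<in> carrier R" and aJ: "\<And>j. j \<in> J \<Longrightarrow> j \<otimes> a = \<zero>"
      using a by (auto simp: right_ann_def)
    have vR: "v \<in> carrier R" and vJ: "\<And>j. j \<in> J \<Longrightarrow> j \<otimes> v = \<zero>"
      using v V by (auto simp: right_ann_def)
    have "i \<otimes> (a \<ominus> v) = \<zero>" if i: "i \<in> I" for i
    proof -
      obtain j r where jr: "j \<in> J" "r \<in> carrier R" "i = j \<oplus> r \<otimes> x"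
        using covers_eq_add_cyclic[OF c x] i by blast
      have jR: "j \<in> carrier R" using JD(1) jr by blast
      have "i \<otimes> a = i \<otimes> v"
        using aJ[OF jr(1)] vJ[OF jr(1)] v(2) jr(2,3) aR vR xR jR by (simp add: l_distr m_assoc)
      then show ?thesis
        using ID(1)[OF i] aR vR by (simp add: a_minus_def r_distr r_minus r_neg)
    qed
    then have "a \<ominus> v \<in> V" using V(2) aR vR by (auto simp: right_ann_def)
    then have "(a \<ominus> v) \<oplus> v \<in> V" using VD(3) v(1) by simp
    then show "a \<in> V" using aR vR by (simp add: a_minus_def a_assoc l_neg)
  qed
  then show ?thesis
    using annI annJ sub ne unfolding covers_def by blast
qed

text \<open>Equal annihilators would give equal double annihilators and force \<open>I\<close> into
  \<open>J\<close>. So the annihilator drops by a simple factor, and passing back through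
  \<open>opp R\<close> shows that the double annihilator of \<open>I\<close> covers
  \<open>J\<close>; as \<open>I\<close> lies in it and strictly above \<open>J\<close>, the two
  coincide.\<close>

lemma double_ann_step:
  assumes c: "covers R J I" and J: "right_ann (opp R) (right_ann R J) = J"
  shows "right_ann (opp R) (right_ann R I) = I" and "right_ann R J \<noteq> right_ann R I"
proof -
  interpret opp: simples_reflexive_ring "opp R" by (rule simples_reflexive_ring_opp)
  have I: "left_ideal R I" and "J \<subset> I" using c by (auto simp: covers_def)
  have sub: "I \<subseteq> right_ann (opp R) (right_ann R I)"
    using left_idealD(1)[OF I] by (auto simp: right_ann_def)
  show ne: "right_ann R J \<noteq> right_ann R I"
  proof
    assume "right_ann R J = right_ann R I"
    then have "I \<subseteq> J" using sub J by simp
    then show False using \<open>J \<subset> I\<close> by blast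
  qed
  have "covers R J (right_ann (opp R) (right_ann R I))"
  proof -
    have "right_ann (opp R) (right_ann R I) \<noteq> right_ann (opp R) (right_ann R J)"
      unfolding J using sub \<open>J \<subset> I\<close> by blast
    then show ?thesis
      using opp.covers_right_ann[OF covers_right_ann[OF c ne]] J by simp
  qed
  then show "right_ann (opp R) (right_ann R I) = I"
    using I sub \<open>J \<subset> I\<close> unfolding covers_def by metis
qed

text \<open>The map factors through \<open>I/J\<close> and is determined by \<open>f x\<close>. This
  value is annihilated by the annihilator of the class of \<open>x\<close>, hence has the form
  \<open>x a\<close> with \<open>a\<close> in \<open>right_ann R J\<close>.\<close>

lemma extension_step:
  assumes c: "covers R J I" and ne: "right_ann R J \<noteq> right_ann R I"
    and f: "left_linear R I f" "\<And>j. j \<in> J \<Longrightarrow> f j = \<zero>"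
  shows "\<exists>a\<in>carrier R. \<forall>x\<in>I. f x = x \<otimes> a"
proof -
  have J: "left_ideal R J" and I: "left_ideal R I" and "J \<subset> I" using c by (auto simp: covers_def)
  note ID = left_idealD[OF I] and JD = left_idealD[OF J]
  obtain x where x: "x \<in> I" "x \<notin> J" using \<open>J \<subset> I\<close> by blast
  have xR: "x \<in> carrier R" using ID(1) x by blast
  have sub: "right_ann R I \<subseteq> right_ann R J" using right_ann_antimono \<open>J \<subset> I\<close> by blast
  have annJ: "left_ideal (opp R) (right_ann R J)"
    using left_ideal_opp_right_ann JD(1) by blast
  have fx: "f x \<in> carrier R" using f(1) x by (simp add: left_linear_def)
  have "b \<otimes> f x = \<zero>" if "b \<in> carrier R" "b \<otimes> x \<in> J" for b
  proof -
    have "b \<otimes> f x = f (b \<otimes> x)" using f(1) x that by (simp add: left_linear_def)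
    then show ?thesis using f(2)[OF that(2)] by simp
  qed
  then have "f x \<in> right_ann R {b \<in> carrier R. b \<otimes> x \<in> J}"
    using fx by (simp add: right_ann_def)
  then have "f x \<in> (\<otimes>) x ` right_ann R J"
    using mult_right_ideal_eq[OF c x annJ] ne sub by simp
  then obtain a where a: "a \<in> right_ann R J" "f x = x \<otimes> a" by blast
  have aR: "a \<in> carrier R" and aJ: "\<And>j. j \<in> J \<Longrightarrow> j \<otimes> a = \<zero>"
    using a by (auto simp: right_ann_def)
  have "f i = i \<otimes> a" if i: "i \<in> I" for i
  proof -
    obtain j r where jr: "j \<in> J" "r \<in> carrier R" "i = j \<oplus> r \<otimes> x"
      using covers_eq_add_cyclic[OF c x] i by blast
    have jR: "j \<in> carrier R" "j \<in> I" using JD(1) jr \<open>J \<subset> I\<close> by auto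
    have "f i = f j \<oplus> r \<otimes> f x"
      using f(1) jR jr x ID(4) by (simp add: left_linear_def)
    then show ?thesis
      using f(2)[OF jr(1)] aJ[OF jr(1)] a(2) jr(2,3) jR xR aR by (simp add: l_distr m_assoc)
  qed
  then show ?thesis using aR by blast
qed

theorem left_linear_extends:
  assumes "left_ideal R I" "left_linear R I f"
  shows "\<exists>a\<in>carrier R. \<forall>x\<in>I. f x = x \<otimes> a"
proof -
  \<comment> \<open>The double annihilator property is proved along with the extension property: for
    \<open>J\<close> it yields that the annihilators of \<open>J\<close> and \<open>I\<close>
    differ, which the extension from \<open>J\<close> to \<open>I\<close> requires.\<close>
  define good where "good I \<longleftrightarrow> right_ann (opp R) (right_ann R I) = I \<and>
    (\<forall>f. left_linear R I f \<longrightarrow> (\<exists>a\<in>carrier R. \<forall>x\<in>I. f x = x \<otimes> a))" for I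
  have "good I" if "left_ideal R I" for I
    using dcc(1) CollectI[of "left_ideal R", OF that]
  proof (induction rule: dcc_on_induct)
    case (less I)
    then have I: "left_ideal R I" and min: "\<And>J. left_ideal R J \<Longrightarrow> J \<subset> I \<Longrightarrow> good J"
      by simp_all
    show "good I"
    proof (cases "I = {\<zero>}")
      case True
      show ?thesis
        unfolding good_def True
      proof (intro conjI allI impI)
        have ann: "right_ann R {\<zero>} = carrier R" by (auto simp: right_ann_def)
        show "right_ann (opp R) (right_ann R {\<zero>}) = {\<zero>}"
        proof
          show "right_ann (opp R) (right_ann R {\<zero>}) \<subseteq> {\<zero>}"
          proof
            fix a assume "a \<in> right_ann (opp R) (right_ann R {\<zero>})"
            then have a: "a \<in> carrier R" and "\<forall>x\<in>carrier R. a \<otimes> x = \<zero>"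
              unfolding ann by (simp_all add: right_ann_def)
            then have "a \<otimes> \<one> = \<zero>" by blast
            then show "a \<in> {\<zero>}" using a by simp
          qed
        qed (simp add: ann, simp add: right_ann_def)
        fix f assume f: "left_linear R {\<zero>} f"
        have "f (\<zero> \<otimes> \<zero>) = \<zero> \<otimes> f \<zero>" "f \<zero> \<in> carrier R"
          using f zero_closed by (simp_all add: left_linear_def)
        then show "\<exists>a\<in>carrier R. \<forall>x\<in>{\<zero>}. f x = x \<otimes> a" by (intro bexI[of _ \<zero>]) auto
      qed
    next
      case False
      note ID = left_idealD[OF I]
      have zero: "left_ideal R {\<zero>}" by (simp add: left_ideal_def)
      have "{\<zero>} \<subset> I" using False ID(2) by blast
      then obtain J where c: "covers R J I"
        by (rule ex_covers_above[OF acc(1) zero I])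
      then have "good J" and J: "left_ideal R J" "J \<subset> I" using min by (auto simp: covers_def)
      then have cl: "right_ann (opp R) (right_ann R J) = J"
        and ext: "\<And>f. left_linear R J f \<Longrightarrow> \<exists>a\<in>carrier R. \<forall>x\<in>J. f x = x \<otimes> a"
        by (simp_all add: good_def)
      note step = double_ann_step[OF c cl]
      have "\<exists>a\<in>carrier R. \<forall>x\<in>I. f x = x \<otimes> a" if f: "left_linear R I f" for f
      proof -
        have "left_linear R J f"
          using f psubset_imp_subset[OF J(2)] by (simp add: left_linear_def subset_iff)
        then obtain a where a: "a \<in> carrier R" "\<And>x. x \<in> J \<Longrightarrow> f x = x \<otimes> a" using ext by blast
        have fD: "\<And>x. x \<in> I \<Longrightarrow> f x \<in> carrier R" "\<And>x y. x \<in> I \<Longrightarrow> y \<in> I \<Longrightarrow> f (x \<oplus> y) = f x \<oplus> f y"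
          "\<And>r x. r \<in> carrier R \<Longrightarrow> x \<in> I \<Longrightarrow> f (r \<otimes> x) = r \<otimes> f x"
          using f by (auto simp: left_linear_def)
        \<comment> \<open>The restriction to \<open>J\<close> is multiplication by \<open>a\<close>;
          subtracting this multiplication on all of \<open>I\<close> leaves a map that vanishes on
          \<open>J\<close>.\<close>
        have "left_linear R I (\<lambda>x. f x \<ominus> x \<otimes> a)"
          unfolding left_linear_def
        proof (intro conjI ballI)
          fix x assume x: "x \<in> I"
          have xR: "x \<in> carrier R" "f x \<in> carrier R" using ID(1) fD(1) x by auto
          show "f x \<ominus> x \<otimes> a \<in> carrier R" using xR a by simp
          show "f (x \<oplus> y) \<ominus> (x \<oplus> y) \<otimes> a = (f x \<ominus> x \<otimes> a) \<oplus> (f y \<ominus> y \<otimes> a)" if y: "y \<in> I" for y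
          proof -
            have yR: "y \<in> carrier R" "f y \<in> carrier R" using ID(1) fD(1) y by auto
            show ?thesis
              using fD(2)[OF x y] xR yR a(1) by (simp add: a_minus_def l_distr minus_add a_ac)
          qed
          show "f (r \<otimes> x) \<ominus> (r \<otimes> x) \<otimes> a = r \<otimes> (f x \<ominus> x \<otimes> a)" if "r \<in> carrier R" for r
            using fD(3)[OF that x] xR that a(1) by (simp add: a_minus_def r_distr r_minus m_assoc)
        qed
        moreover have "f j \<ominus> j \<otimes> a = \<zero>" if "j \<in> J" for j
          using a that left_idealD(1)[OF J(1)] by (simp add: a_minus_def r_neg)
        ultimately obtain b where b: "b \<in> carrier R" "\<And>x. x \<in> I \<Longrightarrow> f x \<ominus> x \<otimes> a = x \<otimes> b"
          using extension_step[OF c step(2), of "\<lambda>x. f x \<ominus> x \<otimes> a"] by blast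
        have "f x = x \<otimes> (b \<oplus> a)" if "x \<in> I" for x
        proof -
          have xR: "x \<in> carrier R" "f x \<in> carrier R" using ID(1) fD(1) that by auto
          have "x \<otimes> (b \<oplus> a) = (f x \<ominus> x \<otimes> a) \<oplus> x \<otimes> a"
            using b(1) b(2)[OF that] xR a(1) by (simp add: r_distr)
          then show ?thesis using xR a(1) by (simp add: a_minus_def a_assoc l_neg)
        qed
        then show ?thesis using a(1) b(1) by blast
      qed
      then show "good I" using step(1) by (simp add: good_def)
    qed
  qed
  then show ?thesis using assms by (simp add: good_def)
qed

end

section \<open>Injectivity of the regular module\<close>

context left_module
begin

lemma smult_zero_left:
  assumes "x \<in> carrier M"
  shows "\<zero> \<odot>\<^bsub>M\<^esub> x = \<zero>\<^bsub>M\<^esub>"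
proof -
  have "\<zero> \<odot>\<^bsub>M\<^esub> x \<oplus>\<^bsub>M\<^esub> \<zero> \<odot>\<^bsub>M\<^esub> x = \<zero> \<odot>\<^bsub>M\<^esub> x"
    using smult_l_distr[of \<zero> \<zero> x] assms by simp
  then show ?thesis using smult_closed[of \<zero> x] assms by simp
qed

lemma smult_minus_one:
  assumes "x \<in> carrier M"
  shows "(\<ominus> \<one>) \<odot>\<^bsub>M\<^esub> x = \<ominus>\<^bsub>M\<^esub> x"
proof (rule sym, rule M.minus_equality)
  show "(\<ominus> \<one>) \<odot>\<^bsub>M\<^esub> x \<oplus>\<^bsub>M\<^esub> x = \<zero>\<^bsub>M\<^esub>"
    using smult_l_distr[of "\<ominus> \<one>" \<one> x] smult_one[OF assms] smult_zero_left[OF assms] assms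
    by (simp add: R.l_neg)
qed (use assms smult_closed in auto)

end

lemma regular_module_simps [simp]:
  "carrier (regular_module R) = carrier R" "\<zero>\<^bsub>regular_module R\<^esub> = \<zero>\<^bsub>R\<^esub>"
  "x \<oplus>\<^bsub>regular_module R\<^esub> y = x \<oplus>\<^bsub>R\<^esub> y" "x \<odot>\<^bsub>regular_module R\<^esub> y = x \<otimes>\<^bsub>R\<^esub> y"
  by (simp_all add: regular_module_def)

lemma (in ring) left_module_regular: "left_module R (regular_module R)"
proof -
  have "abelian_group (regular_module R)"
  proof (rule abelian_groupI)
    fix x assume "x \<in> carrier (regular_module R)"
    then show "\<exists>y\<in>carrier (regular_module R). y \<oplus>\<^bsub>regular_module R\<^esub> x = \<zero>\<^bsub>regular_module R\<^esub>"
      by (intro bexI[of _ "\<ominus> x"]) (simp_all add: l_neg)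
  qed (simp_all add: a_ac)
  then show ?thesis
    by (intro left_module.intro left_module_axioms.intro ring_axioms)
      (simp_all add: l_distr r_distr m_assoc)
qed

text \<open>Baer's criterion; partial extensions are ordered as graphs in \<open>N \<times> R\<close>.\<close>

theorem (in ring) injective_regular_module:
  assumes ext: "\<And>I f. left_ideal R I \<Longrightarrow> left_linear R I f \<Longrightarrow> \<exists>a\<in>carrier R. \<forall>x\<in>I. f x = x \<otimes> a"
  shows "injective_module TYPE('m) TYPE('n) R (regular_module R)"
  unfolding injective_module_def
proof (intro conjI allI impI left_module_regular)
  fix M :: "('a, 'm) module" and N :: "('a, 'n) module" and i f
  assume asm: "left_module R M \<and> left_module R N \<and> i \<in> mod_hom R M N \<and> inj_on i (carrier M) \<and>
    f \<in> mod_hom R M (regular_module R)"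
  interpret M: left_module R M using asm by simp
  interpret N: left_module R N using asm by simp
  have i: "\<And>x. x \<in> carrier M \<Longrightarrow> i x \<in> carrier N"
    "\<And>x y. x \<in> carrier M \<Longrightarrow> y \<in> carrier M \<Longrightarrow> i (x \<oplus>\<^bsub>M\<^esub> y) = i x \<oplus>\<^bsub>N\<^esub> i y"
    "\<And>a x. a \<in> carrier R \<Longrightarrow> x \<in> carrier M \<Longrightarrow> i (a \<odot>\<^bsub>M\<^esub> x) = a \<odot>\<^bsub>N\<^esub> i x"
    using asm by (auto simp: mod_hom_def)
  have f: "\<And>x. x \<in> carrier M \<Longrightarrow> f x \<in> carrier R"
    "\<And>x y. x \<in> carrier M \<Longrightarrow> y \<in> carrier M \<Longrightarrow> f (x \<oplus>\<^bsub>M\<^esub> y) = f x \<oplus> f y"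
    "\<And>a x. a \<in> carrier R \<Longrightarrow> x \<in> carrier M \<Longrightarrow> f (a \<odot>\<^bsub>M\<^esub> x) = a \<otimes> f x"
    using asm by (auto simp: mod_hom_def)
  have i0: "i \<zero>\<^bsub>M\<^esub> = \<zero>\<^bsub>N\<^esub>"
    using i(3)[of \<zero> "\<zero>\<^bsub>M\<^esub>"] i(1)[of "\<zero>\<^bsub>M\<^esub>"] M.smult_zero_left N.smult_zero_left by simp
  have f0: "f \<zero>\<^bsub>M\<^esub> = \<zero>"
    using f(3)[of \<zero> "\<zero>\<^bsub>M\<^esub>"] f(1)[of "\<zero>\<^bsub>M\<^esub>"] M.smult_zero_left by simp
  \<comment> \<open>Graphs of linear maps on submodules of \<open>N\<close> that send
    \<open>i x\<close> to \<open>f x\<close>. By additivity, single-valuedness needs to be required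
    only over zero, which is the form that is easy to check for an enlarged graph.\<close>
  define partial where "partial G \<longleftrightarrow> G \<subseteq> carrier N \<times> carrier R \<and> (\<forall>x\<in>carrier M. (i x, f x) \<in> G) \<and>
    (\<forall>y c y' c'. (y, c) \<in> G \<longrightarrow> (y', c') \<in> G \<longrightarrow> (y \<oplus>\<^bsub>N\<^esub> y', c \<oplus> c') \<in> G) \<and>
    (\<forall>a y c. a \<in> carrier R \<longrightarrow> (y, c) \<in> G \<longrightarrow> (a \<odot>\<^bsub>N\<^esub> y, a \<otimes> c) \<in> G) \<and>
    (\<forall>c. (\<zero>\<^bsub>N\<^esub>, c) \<in> G \<longrightarrow> c = \<zero>)" for G
  have partialD: "\<And>y c. (y, c) \<in> G \<Longrightarrow> y \<in> carrier N" "\<And>y c. (y, c) \<in> G \<Longrightarrow> c \<in> carrier R"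
    "\<And>x. x \<in> carrier M \<Longrightarrow> (i x, f x) \<in> G"
    "\<And>y c y' c'. (y, c) \<in> G \<Longrightarrow> (y', c') \<in> G \<Longrightarrow> (y \<oplus>\<^bsub>N\<^esub> y', c \<oplus> c') \<in> G"
    "\<And>a y c. a \<in> carrier R \<Longrightarrow> (y, c) \<in> G \<Longrightarrow> (a \<odot>\<^bsub>N\<^esub> y, a \<otimes> c) \<in> G"
    "\<And>c. (\<zero>\<^bsub>N\<^esub>, c) \<in> G \<Longrightarrow> c = \<zero>" if "partial G" for G
    using that unfolding partial_def by auto
  have neg: "(\<ominus>\<^bsub>N\<^esub> y, \<ominus> c) \<in> G" if "partial G" "(y, c) \<in> G" for G y c
    using partialD(5)[OF that(1), of "\<ominus> \<one>" y c] partialD(1,2)[OF that] that(2)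
    by (simp add: N.smult_minus_one l_minus)
  have functional: "c = c'" if G: "partial G" and yc: "(y, c) \<in> G" "(y, c') \<in> G" for G y c c'
  proof -
    have R: "y \<in> carrier N" "c \<in> carrier R" "c' \<in> carrier R" using partialD(1,2)[OF G] yc by auto
    have "(y \<oplus>\<^bsub>N\<^esub> \<ominus>\<^bsub>N\<^esub> y, c \<oplus> \<ominus> c') \<in> G" using partialD(4)[OF G yc(1) neg[OF G yc(2)]] .
    then have "c \<oplus> \<ominus> c' = \<zero>" using partialD(6)[OF G] R by (simp add: N.M.r_neg)
    then have "c \<oplus> \<ominus> c' \<oplus> c' = c'" using R by simp
    then show ?thesis using R by (simp add: a_assoc l_neg)
  qed
  define G0 where "G0 = (\<lambda>x. (i x, f x)) ` carrier M"
  have G0: "partial G0"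
    unfolding partial_def
  proof (intro conjI allI impI ballI)
    show "G0 \<subseteq> carrier N \<times> carrier R" using i(1) f(1) by (auto simp: G0_def)
    show "(i x, f x) \<in> G0" if "x \<in> carrier M" for x using that by (simp add: G0_def)
    show "(y \<oplus>\<^bsub>N\<^esub> y', c \<oplus> c') \<in> G0" if yc: "(y, c) \<in> G0" "(y', c') \<in> G0" for y c y' c'
    proof -
      obtain x x' where "x \<in> carrier M" "x' \<in> carrier M" "y = i x" "c = f x" "y' = i x'" "c' = f x'"
        using yc by (auto simp: G0_def)
      then show ?thesis
        using i(2) f(2) by (auto simp: G0_def intro!: image_eqI[of _ _ "x \<oplus>\<^bsub>M\<^esub> x'"])
    qed
    show "(a \<odot>\<^bsub>N\<^esub> y, a \<otimes> c) \<in> G0" if a: "a \<in> carrier R" and yc: "(y, c) \<in> G0" for a y c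
    proof -
      obtain x where "x \<in> carrier M" "y = i x" "c = f x"
        using yc by (auto simp: G0_def)
      then show ?thesis
        using i(3) f(3) a M.smult_closed by (auto simp: G0_def intro!: image_eqI[of _ _ "a \<odot>\<^bsub>M\<^esub> x"])
    qed
    \<comment> \<open>Injectivity of \<open>i\<close> is what makes \<open>f\<close> well defined on
      the image of \<open>i\<close>.\<close>
    show "c = \<zero>" if c: "(\<zero>\<^bsub>N\<^esub>, c) \<in> G0" for c
    proof -
      obtain x where x: "x \<in> carrier M" "i x = \<zero>\<^bsub>N\<^esub>" "c = f x"
        using c by (auto simp: G0_def)
      then have "x = \<zero>\<^bsub>M\<^esub>"
        using i0 asm by (metis M.M.zero_closed inj_onD)
      then show ?thesis using x f0 by simp
    qed
  qed
  have chain: "partial (\<Union>C)" if ne: "C \<noteq> {}" and C: "subset.chain (Collect partial) C" for C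
  proof -
    have mem: "partial G" if "G \<in> C" for G
      using C that by (auto simp: subset.chain_def)
    have common: "\<exists>G\<in>C. p \<in> G \<and> q \<in> G" if pq: "p \<in> \<Union>C" "q \<in> \<Union>C" for p q
    proof -
      obtain G H where GH: "G \<in> C" "H \<in> C" "p \<in> G" "q \<in> H" using pq by blast
      then have "G \<subseteq> H \<or> H \<subseteq> G" using C by (auto simp: subset.chain_def)
      then show ?thesis using GH by blast
    qed
    show ?thesis
      unfolding partial_def
    proof (intro conjI allI impI ballI)
      show "\<Union>C \<subseteq> carrier N \<times> carrier R" using partialD(1,2)[OF mem] by fast
      show "(i x, f x) \<in> \<Union>C" if "x \<in> carrier M" for x
        using partialD(3)[OF mem] that ne by fast
      show "(y \<oplus>\<^bsub>N\<^esub> y', c \<oplus> c') \<in> \<Union>C" if "(y, c) \<in> \<Union>C" "(y', c') \<in> \<Union>C" for y c y' c'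
        using common[OF that] partialD(4)[OF mem] by fast
      show "(a \<odot>\<^bsub>N\<^esub> y, a \<otimes> c) \<in> \<Union>C" if "a \<in> carrier R" "(y, c) \<in> \<Union>C" for a y c
        using that partialD(5)[OF mem] by fast
      show "c = \<zero>" if "(\<zero>\<^bsub>N\<^esub>, c) \<in> \<Union>C" for c
        using that partialD(6)[OF mem] by fast
    qed
  qed
  have "Collect partial \<noteq> {}" using G0 by blast
  then obtain G where "G \<in> Collect partial" and max: "\<forall>H\<in>Collect partial. G \<subseteq> H \<longrightarrow> H = G"
    using subset_Zorn_nonempty[of "Collect partial"] chain by (metis mem_Collect_eq)
  then have G: "partial G" by simp
  note GD = partialD[OF G]
  have G_zero: "(\<zero>\<^bsub>N\<^esub>, \<zero>) \<in> G" using GD(3)[of "\<zero>\<^bsub>M\<^esub>"] i0 f0 by simp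
  have total: "\<exists>c. (y, c) \<in> G" if y: "y \<in> carrier N" for y
  proof -
    \<comment> \<open>\<open>I\<close> consists of the scalars that move \<open>y\<close> into the
      domain of \<open>G\<close>, and \<open>h\<close> gives the values there. If \<open>h\<close>
      is multiplication by \<open>u\<close>, then \<open>u\<close> is a consistent value at
      \<open>y\<close> itself.\<close>
    define I where "I = {a \<in> carrier R. \<exists>c. (a \<odot>\<^bsub>N\<^esub> y, c) \<in> G}"
    define h where "h a = (THE c. (a \<odot>\<^bsub>N\<^esub> y, c) \<in> G)" for a
    have h: "h a = c" if "(a \<odot>\<^bsub>N\<^esub> y, c) \<in> G" for a c
      unfolding h_def using that functional[OF G] by blast
    have addG: "((a \<oplus> b) \<odot>\<^bsub>N\<^esub> y, c \<oplus> d) \<in> G"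
      if "(a \<odot>\<^bsub>N\<^esub> y, c) \<in> G" "(b \<odot>\<^bsub>N\<^esub> y, d) \<in> G" "a \<in> carrier R" "b \<in> carrier R" for a b c d
      using GD(4)[OF that(1,2)] that(3,4) y by (simp add: N.smult_l_distr)
    have multG: "((a \<otimes> b) \<odot>\<^bsub>N\<^esub> y, a \<otimes> d) \<in> G"
      if "(b \<odot>\<^bsub>N\<^esub> y, d) \<in> G" "a \<in> carrier R" "b \<in> carrier R" for a b d
      using GD(5)[OF that(2,1)] that(2,3) y by (simp add: N.smult_assoc)
    have "left_ideal R I"
      unfolding left_ideal_def
    proof (intro conjI ballI)
      show "\<zero> \<in> I" using G_zero y by (auto simp: I_def N.smult_zero_left)
      show "a \<oplus> b \<in> I" if "a \<in> I" "b \<in> I" for a b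
        using that addG unfolding I_def by blast
      show "a \<otimes> b \<in> I" if "a \<in> carrier R" "b \<in> I" for a b
        using that multG unfolding I_def by blast
    qed (auto simp: I_def)
    moreover have "left_linear R I h"
      unfolding left_linear_def
    proof (intro conjI ballI)
      fix b assume "b \<in> I"
      then obtain d where d: "b \<in> carrier R" "(b \<odot>\<^bsub>N\<^esub> y, d) \<in> G" by (auto simp: I_def)
      show "h b \<in> carrier R" using h[OF d(2)] GD(2)[OF d(2)] by simp
      show "h (b \<oplus> a) = h b \<oplus> h a" if a: "a \<in> I" for a
      proof -
        obtain c where c: "a \<in> carrier R" "(a \<odot>\<^bsub>N\<^esub> y, c) \<in> G" using a by (auto simp: I_def)
        then show ?thesis using h[OF addG[OF d(2) c(2) d(1) c(1)]] h[OF d(2)] h[OF c(2)] by simp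
      qed
      show "h (a \<otimes> b) = a \<otimes> h b" if "a \<in> carrier R" for a
        using h[OF multG[OF d(2) that d(1)]] h[OF d(2)] by simp
    qed
    ultimately obtain u where u: "u \<in> carrier R" "\<And>a. a \<in> I \<Longrightarrow> h a = a \<otimes> u"
      using ext by blast
    define H where "H = {(z \<oplus>\<^bsub>N\<^esub> a \<odot>\<^bsub>N\<^esub> y, c \<oplus> a \<otimes> u) | z a c. (z, c) \<in> G \<and> a \<in> carrier R}"
    have HI: "(z \<oplus>\<^bsub>N\<^esub> a \<odot>\<^bsub>N\<^esub> y, c \<oplus> a \<otimes> u) \<in> H" if "(z, c) \<in> G" "a \<in> carrier R" for z a c
      using that by (auto simp: H_def)
    have GH: "G \<subseteq> H"
    proof clarify
      fix z c assume z: "(z, c) \<in> G"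
      then show "(z, c) \<in> H"
        using HI[OF z, of \<zero>] GD(1,2)[OF z] y u(1) by (simp add: N.smult_zero_left)
    qed
    have "partial H"
      unfolding partial_def
    proof (intro conjI allI impI ballI)
      show "H \<subseteq> carrier N \<times> carrier R"
        using GD(1,2) y u(1) N.smult_closed by (auto simp: H_def)
      show "(i x, f x) \<in> H" if "x \<in> carrier M" for x using that GD(3) GH by blast
      show "(w \<oplus>\<^bsub>N\<^esub> w', d \<oplus> d') \<in> H" if w: "(w, d) \<in> H" "(w', d') \<in> H" for w d w' d'
      proof -
        obtain z a c where z: "w = z \<oplus>\<^bsub>N\<^esub> a \<odot>\<^bsub>N\<^esub> y" "d = c \<oplus> a \<otimes> u" "(z, c) \<in> G" "a \<in> carrier R"
          using w by (auto simp: H_def)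
        obtain z' a' c' where z': "w' = z' \<oplus>\<^bsub>N\<^esub> a' \<odot>\<^bsub>N\<^esub> y" "d' = c' \<oplus> a' \<otimes> u" "(z', c') \<in> G" "a' \<in> carrier R"
          using w by (auto simp: H_def)
        have "w \<oplus>\<^bsub>N\<^esub> w' = (z \<oplus>\<^bsub>N\<^esub> z') \<oplus>\<^bsub>N\<^esub> (a \<oplus> a') \<odot>\<^bsub>N\<^esub> y"
          using z(1,4) z'(1,4) GD(1)[OF z(3)] GD(1)[OF z'(3)] y
          by (simp add: N.smult_l_distr N.smult_closed N.M.a_ac)
        moreover have "d \<oplus> d' = (c \<oplus> c') \<oplus> (a \<oplus> a') \<otimes> u"
          using z(2,4) z'(2,4) GD(2)[OF z(3)] GD(2)[OF z'(3)] u(1) by (simp add: l_distr a_ac)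
        ultimately show ?thesis using HI[OF GD(4)[OF z(3) z'(3)], of "a \<oplus> a'"] z(4) z'(4) by simp
      qed
      show "(b \<odot>\<^bsub>N\<^esub> w, b \<otimes> d) \<in> H" if b: "b \<in> carrier R" and w: "(w, d) \<in> H" for b w d
      proof -
        obtain z a c where z: "w = z \<oplus>\<^bsub>N\<^esub> a \<odot>\<^bsub>N\<^esub> y" "d = c \<oplus> a \<otimes> u" "(z, c) \<in> G" "a \<in> carrier R"
          using w by (auto simp: H_def)
        have "b \<odot>\<^bsub>N\<^esub> w = b \<odot>\<^bsub>N\<^esub> z \<oplus>\<^bsub>N\<^esub> (b \<otimes> a) \<odot>\<^bsub>N\<^esub> y"
          using z(1,4) GD(1)[OF z(3)] y b by (simp add: N.smult_r_distr N.smult_assoc N.smult_closed)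
        moreover have "b \<otimes> d = b \<otimes> c \<oplus> (b \<otimes> a) \<otimes> u"
          using z(2,4) GD(2)[OF z(3)] u(1) b by (simp add: r_distr m_assoc)
        ultimately show ?thesis using HI[OF GD(5)[OF b z(3)], of "b \<otimes> a"] z(4) b by simp
      qed
      \<comment> \<open>If \<open>z + a y = 0\<close>, then \<open>a y\<close> is in the domain of
        \<open>G\<close> with value \<open>- c\<close>. By the choice of \<open>u\<close> this value
        is also \<open>a u\<close>, so the two contributions to \<open>d\<close> cancel.\<close>
      show "d = \<zero>" if d: "(\<zero>\<^bsub>N\<^esub>, d) \<in> H" for d
      proof -
        obtain z a c where z: "z \<oplus>\<^bsub>N\<^esub> a \<odot>\<^bsub>N\<^esub> y = \<zero>\<^bsub>N\<^esub>" "d = c \<oplus> a \<otimes> u" "(z, c) \<in> G" "a \<in> carrier R"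
          using d by (auto simp: H_def)
        have zN: "z \<in> carrier N" "c \<in> carrier R" using GD(1,2)[OF z(3)] by auto
        have "\<ominus>\<^bsub>N\<^esub> z = a \<odot>\<^bsub>N\<^esub> y"
          using z(1,4) zN y N.smult_closed by (intro N.M.minus_equality) (simp_all add: N.M.a_comm)
        then have aG: "(a \<odot>\<^bsub>N\<^esub> y, \<ominus> c) \<in> G" using neg[OF G z(3)] by simp
        then have "\<ominus> c = a \<otimes> u" using h[OF aG] u(2)[of a] z(4) by (auto simp: I_def)
        then show ?thesis using z(2) zN by (metis r_neg)
      qed
    qed
    then have "H = G" using max GH by blast
    moreover have "(y, u) \<in> H"
      using HI[OF G_zero, of \<one>] y u(1) by (simp add: N.smult_one)
    ultimately show ?thesis by blast
  qed
  define g where "g = (\<lambda>y\<in>carrier N. THE c. (y, c) \<in> G)"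
  have g: "g y = c" if "(y, c) \<in> G" for y c
    unfolding g_def using that GD(1)[OF that] functional[OF G] by (auto intro!: the_equality)
  have gG: "(y, g y) \<in> G" if "y \<in> carrier N" for y
    using total[OF that] g by blast
  have "g \<in> mod_hom R N (regular_module R)"
    unfolding mod_hom_def
  proof (intro CollectI conjI ballI PiE_I)
    show "g y \<in> carrier (regular_module R)" if "y \<in> carrier N" for y
      using GD(2)[OF gG[OF that]] by simp
    show "g y = undefined" if "y \<notin> carrier N" for y using that by (simp add: g_def)
    show "g (y \<oplus>\<^bsub>N\<^esub> z) = g y \<oplus>\<^bsub>regular_module R\<^esub> g z" if "y \<in> carrier N" "z \<in> carrier N" for y z
      using g[OF GD(4)[OF gG[OF that(1)] gG[OF that(2)]]] by simp
    show "g (a \<odot>\<^bsub>N\<^esub> y) = a \<odot>\<^bsub>regular_module R\<^esub> g y" if "a \<in> carrier R" "y \<in> carrier N" for a y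
      using g[OF GD(5)[OF that(1) gG[OF that(2)]]] by simp
  qed
  moreover have "\<forall>x\<in>carrier M. g (i x) = f x" using g GD(3) by blast
  ultimately show "\<exists>g\<in>mod_hom R N (regular_module R). \<forall>x\<in>carrier M. g (i x) = f x" by blast
qed

section \<open>Reflexive simple modules\<close>

definition coset :: "('a, 'b) ring_scheme \<Rightarrow> 'a set \<Rightarrow> 'a \<Rightarrow> 'a set" where
  "coset R I x = {y \<in> carrier R. x \<ominus>\<^bsub>R\<^esub> y \<in> I}"

definition rep :: "'a set \<Rightarrow> 'a" where
  "rep C = (SOME x. x \<in> C)"

text \<open>The elements are cosets as sets, so the module has the type over which reflexivity of
  simple modules is assumed. The operations go through chosen representatives, and independence of
  the choice is proved afterwards.\<close>

definition quotient_module :: "('a, 'b) ring_scheme \<Rightarrow> 'a set \<Rightarrow> ('a, 'a set) module" where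
  "quotient_module R I = \<lparr>carrier = coset R I ` carrier R, monoid.mult = undefined, monoid.one = undefined,
     ring.zero = coset R I \<zero>\<^bsub>R\<^esub>,
     ring.add = (\<lambda>C D. coset R I (rep C \<oplus>\<^bsub>R\<^esub> rep D)),
     smult = (\<lambda>a C. coset R I (a \<otimes>\<^bsub>R\<^esub> rep C))\<rparr>"

section \<open>The cyclic module of a left ideal and its dual\<close>

locale ring_left_ideal = ring +
  fixes I
  assumes I: "left_ideal R I"
begin

abbreviation "cl \<equiv> coset R I"
abbreviation "Q \<equiv> quotient_module R I"

lemma coset_eq_iff:
  assumes x: "x \<in> carrier R" and y: "y \<in> carrier R"
  shows "cl x = cl y \<longleftrightarrow> x \<ominus> y \<in> I"
proof
  assume "cl x = cl y"
  moreover have "y \<in> cl y" using y left_idealD(2)[OF I] by (simp add: coset_def a_minus_def r_neg)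
  ultimately have "y \<in> cl x" by simp
  then show "x \<ominus> y \<in> I" by (simp add: coset_def)
next
  assume xy: "x \<ominus> y \<in> I"
  have "x \<ominus> z \<in> I \<longleftrightarrow> y \<ominus> z \<in> I" if z: "z \<in> carrier R" for z
  proof -
    have "x \<ominus> z = (x \<ominus> y) \<oplus> (y \<ominus> z)"
      using x y z by (simp add: a_minus_def a_assoc r_neg1)
    moreover have "y \<ominus> z = (x \<ominus> z) \<ominus> (x \<ominus> y)"
      using x y z by (simp add: a_minus_def minus_add a_ac r_neg1 r_neg2)
    ultimately show ?thesis using left_idealD(3,6)[OF I] xy by metis
  qed
  then show "cl x = cl y" by (auto simp: coset_def)
qed

lemma rep_coset:
  assumes "x \<in> carrier R"
  shows "rep (cl x) \<in> carrier R" and "cl (rep (cl x)) = cl x"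
proof -
  have "x \<in> cl x" using assms left_idealD(2)[OF I] by (simp add: coset_def a_minus_def r_neg)
  then have *: "rep (cl x) \<in> cl x" unfolding rep_def by (rule someI)
  then show R: "rep (cl x) \<in> carrier R" by (simp add: coset_def)
  show "cl (rep (cl x)) = cl x"
    using * coset_eq_iff[OF assms R] by (simp add: coset_def)
qed

lemma quotient_carrier: "carrier Q = cl ` carrier R"
  and quotient_zero: "\<zero>\<^bsub>Q\<^esub> = cl \<zero>"
  by (simp_all add: quotient_module_def)

lemma coset_in_quotient [simp]: "x \<in> carrier R \<Longrightarrow> cl x \<in> carrier Q"
  by (simp add: quotient_carrier)

lemma quotient_add:
  assumes x: "x \<in> carrier R" and y: "y \<in> carrier R"
  shows "cl x \<oplus>\<^bsub>Q\<^esub> cl y = cl (x \<oplus> y)"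
proof -
  note r = rep_coset[OF x] rep_coset[OF y]
  have "rep (cl x) \<ominus> x \<in> I" "rep (cl y) \<ominus> y \<in> I" using coset_eq_iff r x y by blast+
  then have "(rep (cl x) \<ominus> x) \<oplus> (rep (cl y) \<ominus> y) \<in> I" using left_idealD(3)[OF I] by blast
  also have "(rep (cl x) \<ominus> x) \<oplus> (rep (cl y) \<ominus> y) = (rep (cl x) \<oplus> rep (cl y)) \<ominus> (x \<oplus> y)"
    using r x y by (simp add: a_minus_def minus_add a_ac)
  finally show ?thesis
    using coset_eq_iff r x y by (simp add: quotient_module_def)
qed

lemma quotient_smult:
  assumes a: "a \<in> carrier R" and x: "x \<in> carrier R"
  shows "a \<odot>\<^bsub>Q\<^esub> cl x = cl (a \<otimes> x)"
proof -
  note r = rep_coset[OF x]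
  have "rep (cl x) \<ominus> x \<in> I" using coset_eq_iff r x by blast
  then have "a \<otimes> (rep (cl x) \<ominus> x) \<in> I" using left_idealD(4)[OF I] a by blast
  also have "a \<otimes> (rep (cl x) \<ominus> x) = a \<otimes> rep (cl x) \<ominus> a \<otimes> x"
    using r x a by (simp add: a_minus_def r_distr r_minus)
  finally show ?thesis
    using coset_eq_iff r x a by (simp add: quotient_module_def)
qed

lemma quotientE:
  assumes "C \<in> carrier Q"
  obtains x where "x \<in> carrier R" "C = cl x"
  using assms by (auto simp: quotient_carrier)

lemma left_module_quotient: "left_module R Q"
proof -
  have "abelian_group Q"
  proof (rule abelian_groupI)
    show "C \<oplus>\<^bsub>Q\<^esub> D \<in> carrier Q" if "C \<in> carrier Q" "D \<in> carrier Q" for C D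
      using that by (auto elim!: quotientE simp: quotient_add)
    show "\<zero>\<^bsub>Q\<^esub> \<in> carrier Q" by (simp add: quotient_zero)
    show "(C \<oplus>\<^bsub>Q\<^esub> D) \<oplus>\<^bsub>Q\<^esub> E = C \<oplus>\<^bsub>Q\<^esub> (D \<oplus>\<^bsub>Q\<^esub> E)"
      if "C \<in> carrier Q" "D \<in> carrier Q" "E \<in> carrier Q" for C D E
      using that by (auto elim!: quotientE simp: quotient_add a_assoc)
    show "C \<oplus>\<^bsub>Q\<^esub> D = D \<oplus>\<^bsub>Q\<^esub> C" if "C \<in> carrier Q" "D \<in> carrier Q" for C D
      using that by (auto elim!: quotientE simp: quotient_add a_comm)
    show "\<zero>\<^bsub>Q\<^esub> \<oplus>\<^bsub>Q\<^esub> C = C" if "C \<in> carrier Q" for C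
      using that by (auto elim!: quotientE simp: quotient_add quotient_zero)
    show "\<exists>D\<in>carrier Q. D \<oplus>\<^bsub>Q\<^esub> C = \<zero>\<^bsub>Q\<^esub>" if "C \<in> carrier Q" for C
    proof -
      obtain x where x: "x \<in> carrier R" "C = cl x" using \<open>C \<in> carrier Q\<close> by (rule quotientE)
      then have "cl (\<ominus> x) \<oplus>\<^bsub>Q\<^esub> C = \<zero>\<^bsub>Q\<^esub>" by (simp add: quotient_add quotient_zero l_neg)
      then show ?thesis using x by (intro bexI[of _ "cl (\<ominus> x)"]) simp_all
    qed
  qed
  moreover have "left_module_axioms R Q"
    by (rule left_module_axioms.intro)
      (auto elim!: quotientE simp: quotient_add quotient_smult l_distr r_distr m_assoc)
  ultimately show ?thesis by (intro left_module.intro ring_axioms)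
qed

text \<open>Submodules correspond to the left ideals containing \<open>I\<close>, by taking
  preimages under the coset map.\<close>

lemma simple_quotient:
  assumes max: "maximal_left_ideal R I"
  shows "simple_left R Q"
  unfolding simple_left_def
proof (intro conjI allI impI left_module_quotient)
  have "\<one> \<notin> I" using max left_ideal_eq_carrier unfolding maximal_left_ideal_def by blast
  then have "cl \<one> \<noteq> cl \<zero>" using coset_eq_iff[of \<one> \<zero>] by (simp add: a_minus_def)
  then show "carrier Q \<noteq> {\<zero>\<^bsub>Q\<^esub>}"
    using coset_in_quotient[of \<one>] by (auto simp: quotient_zero)
  fix H assume H: "submodule H R Q"
  interpret Q: left_module R Q by (rule left_module_quotient)
  interpret H: submodule H R Q by (rule H)
  define J where "J = {x \<in> carrier R. cl x \<in> H}"
  have HJ: "H = cl ` J"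
    using H.subset by (auto simp: J_def quotient_carrier)
  have zero: "cl \<zero> \<in> H" using H.one_closed by (simp add: quotient_zero)
  have J: "left_ideal R J"
    unfolding left_ideal_def
  proof (intro conjI ballI)
    show "\<zero> \<in> J" using zero by (simp add: J_def)
    show "x \<oplus> y \<in> J" if "x \<in> J" "y \<in> J" for x y
      using that H.m_closed[of "cl x" "cl y"] by (simp add: J_def quotient_add)
    show "a \<otimes> x \<in> J" if "a \<in> carrier R" "x \<in> J" for a x
      using that H.smult_closed[of a "cl x"] by (simp add: J_def quotient_smult)
  qed (auto simp: J_def)
  have cl0: "cl x = cl \<zero> \<longleftrightarrow> x \<in> I" if "x \<in> carrier R" for x
    using coset_eq_iff[OF that zero_closed] that by (simp add: a_minus_def)
  have "x \<in> J" if "x \<in> I" for x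
    using that zero cl0[of x] left_idealD(1)[OF I] by (simp add: J_def)
  then have "I \<subseteq> J" ..
  then consider "J = I" | "J = carrier R"
    using J max unfolding maximal_left_ideal_def by blast
  then show "H = {\<zero>\<^bsub>Q\<^esub>} \<or> H = carrier Q"
  proof cases
    case 1
    have "cl ` I = {cl \<zero>}"
    proof -
      have "cl x = cl \<zero>" if "x \<in> I" for x using cl0 left_idealD(1)[OF I] that by blast
      then show ?thesis using left_idealD(2)[OF I] by blast
    qed
    then show ?thesis using HJ 1 by (simp add: quotient_zero)
  next
    case 2
    then show ?thesis using HJ by (simp add: quotient_carrier)
  qed
qed

text \<open>A functional on a cyclic module is determined by its value at the generator
  \<open>cl \<one>\<close>, and this value is killed by whatever kills the generator.\<close>

lemma dual_quotient_value:
  assumes g: "g \<in> carrier (dual R Q)"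
  shows "g (cl \<one>) \<in> right_ann R I" and "\<And>x. x \<in> carrier R \<Longrightarrow> g (cl x) = x \<otimes> g (cl \<one>)"
proof -
  have gD: "\<And>C. C \<in> carrier Q \<Longrightarrow> g C \<in> carrier R"
    "\<And>a C. a \<in> carrier R \<Longrightarrow> C \<in> carrier Q \<Longrightarrow> g (a \<odot>\<^bsub>Q\<^esub> C) = a \<otimes> g C"
    using g by (auto simp: dual_def mod_hom_def)
  show *: "g (cl x) = x \<otimes> g (cl \<one>)" if "x \<in> carrier R" for x
    using gD(2)[OF that, of "cl \<one>"] that by (simp add: quotient_smult)
  have R: "g (cl \<one>) \<in> carrier R" using gD(1) by simp
  have "x \<otimes> g (cl \<one>) = \<zero>" if "x \<in> I" for x
  proof -
    have xR: "x \<in> carrier R" using left_idealD(1)[OF I] that by blast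
    have "cl x = cl \<zero>" using coset_eq_iff[OF xR zero_closed] that xR by (simp add: a_minus_def)
    then have "x \<otimes> g (cl \<one>) = \<zero> \<otimes> g (cl \<one>)" using *[OF xR] *[OF zero_closed] by simp
    then show ?thesis using R by simp
  qed
  then show "g (cl \<one>) \<in> right_ann R I" using R by (simp add: right_ann_def)
qed

text \<open>The converse half of the identification of the dual with \<open>right_ann R I\<close>:
  multiplication of a representative by \<open>a\<close> does not depend on the representative,
  because \<open>I a = 0\<close>.\<close>

lemma dual_quotient_of_ann:
  assumes a: "a \<in> right_ann R I"
  obtains g where "g \<in> carrier (dual R Q)" "g (cl \<one>) = a"
proof -
  have aR: "a \<in> carrier R" and aI: "\<And>x. x \<in> I \<Longrightarrow> x \<otimes> a = \<zero>" using a by (auto simp: right_ann_def)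
  define g where "g = (\<lambda>C\<in>carrier Q. rep C \<otimes> a)"
  have g: "g (cl x) = x \<otimes> a" if x: "x \<in> carrier R" for x
  proof -
    note r = rep_coset[OF x]
    have "rep (cl x) \<ominus> x \<in> I" using coset_eq_iff r x by blast
    then have "(rep (cl x) \<ominus> x) \<otimes> a \<oplus> x \<otimes> a = x \<otimes> a" using aI aR x by simp
    then show ?thesis
      using r x aR by (simp add: g_def a_minus_def l_distr l_minus a_assoc l_neg)
  qed
  have "g \<in> mod_hom R Q (regular_module R)"
    unfolding mod_hom_def
  proof (intro CollectI conjI ballI PiE_I)
    show "g C \<in> carrier (regular_module R)" if "C \<in> carrier Q" for C
      using that g aR by (auto elim!: quotientE)
    show "g C = undefined" if "C \<notin> carrier Q" for C using that by (simp add: g_def)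
    show "g (C \<oplus>\<^bsub>Q\<^esub> D) = g C \<oplus>\<^bsub>regular_module R\<^esub> g D" if "C \<in> carrier Q" "D \<in> carrier Q" for C D
      using that g aR by (auto elim!: quotientE simp: quotient_add l_distr)
    show "g (b \<odot>\<^bsub>Q\<^esub> C) = b \<odot>\<^bsub>regular_module R\<^esub> g C" if "b \<in> carrier R" "C \<in> carrier Q" for b C
      using that g aR by (auto elim!: quotientE simp: quotient_smult m_assoc)
  qed
  then have "g \<in> carrier (dual R Q)" by (simp add: dual_def)
  moreover have "g (cl \<one>) = a" using g aR by simp
  ultimately show thesis by (rule that)
qed

text \<open>When the dual is identified with \<open>right_ann R I\<close>, evaluation at the class
  of \<open>x\<close> becomes left multiplication by \<open>x\<close>. Injectivity and surjectivity
  of evaluation then turn into the two conclusions.\<close>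

lemma reflexive_quotient_cond:
  assumes "reflexive_left R Q"
  shows "\<forall>x\<in>carrier R - I. \<exists>a\<in>right_ann R I. x \<otimes> a \<noteq> \<zero>"
    and "left_linear (opp R) (right_ann R I) f \<Longrightarrow> \<exists>x\<in>carrier R. \<forall>a\<in>right_ann R I. f a = x \<otimes> a"
proof -
  have bij: "bij_betw (eval_map R Q) (carrier Q) (carrier (bidual R Q))"
    using assms by (auto simp: reflexive_left_def mod_iso_def)
  have ev: "eval_map R Q (cl x) g = x \<otimes> g (cl \<one>)" if "x \<in> carrier R" "g \<in> carrier (dual R Q)" for x g
    using that dual_quotient_value(2) by (simp add: eval_map_def)
  show "\<forall>x\<in>carrier R - I. \<exists>a\<in>right_ann R I. x \<otimes> a \<noteq> \<zero>"
  proof (rule ccontr)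
    assume "\<not> ?thesis"
    then obtain x where x: "x \<in> carrier R" "x \<notin> I" and xa: "\<And>a. a \<in> right_ann R I \<Longrightarrow> x \<otimes> a = \<zero>"
      by blast
    have "eval_map R Q (cl x) = eval_map R Q (cl \<zero>)"
    proof
      fix g
      show "eval_map R Q (cl x) g = eval_map R Q (cl \<zero>) g"
      proof (cases "g \<in> carrier (dual R Q)")
        case True
        then have "g (cl \<one>) \<in> right_ann R I" by (rule dual_quotient_value)
        then show ?thesis
          using ev[OF x(1) True] ev[OF zero_closed True] xa by (simp add: right_ann_def)
      next
        case False
        then show ?thesis using x by (simp add: eval_map_def)
      qed
    qed
    then have "cl x = cl \<zero>"
      using bij x by (meson bij_betw_imp_inj_on coset_in_quotient inj_onD zero_closed)
    then show False using coset_eq_iff[OF x(1) zero_closed] x by (simp add: a_minus_def)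
  qed
  \<comment> \<open>To use surjectivity, \<open>f\<close> is turned into an element of the bidual by
    evaluating functionals at the generator first.\<close>
  assume f: "left_linear (opp R) (right_ann R I) f"
  define \<psi> where "\<psi> = (\<lambda>g\<in>carrier (dual R Q). f (g (cl \<one>)))"
  have val: "g (cl \<one>) \<in> right_ann R I" if "g \<in> carrier (dual R Q)" for g
    using dual_quotient_value(1)[OF that] .
  interpret opp: ring "opp R" by (rule ring_opp)
  have ann: "left_ideal (opp R) (right_ann R I)"
    using opp.left_ideal_right_ann_opp[of I] left_idealD(1)[OF I] by auto
  have "\<psi> \<in> mod_hom (opp R) (dual R Q) (regular_module (opp R))"
  proof -
    \<comment> \<open>Closure of the dual is obtained from the annihilator: the sum of the two
      values lies in it, belongs to some functional \<open>k\<close>, and \<open>k\<close> agrees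
      with the pointwise sum everywhere, outside the carrier by extensionality. Scalar multiples are
      treated alike.\<close>
    have add_closed: "g \<oplus>\<^bsub>dual R Q\<^esub> h \<in> carrier (dual R Q)" and add_val: "(g \<oplus>\<^bsub>dual R Q\<^esub> h) (cl \<one>) = g (cl \<one>) \<oplus> h (cl \<one>)"
      if g: "g \<in> carrier (dual R Q)" and h: "h \<in> carrier (dual R Q)" for g h
    proof -
      show v: "(g \<oplus>\<^bsub>dual R Q\<^esub> h) (cl \<one>) = g (cl \<one>) \<oplus> h (cl \<one>)" by (simp add: dual_def)
      have "g (cl \<one>) \<oplus> h (cl \<one>) \<in> right_ann R I"
        using opp.left_idealD(3)[OF ann] val g h by simp
      then obtain k where k: "k \<in> carrier (dual R Q)" "k (cl \<one>) = g (cl \<one>) \<oplus> h (cl \<one>)"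
        by (rule dual_quotient_of_ann)
      have R: "g (cl \<one>) \<in> carrier R" "h (cl \<one>) \<in> carrier R" using val g h by (auto simp: right_ann_def)
      have "(g \<oplus>\<^bsub>dual R Q\<^esub> h) C = k C" for C
      proof (cases "C \<in> carrier Q")
        case True
        then obtain x where x: "x \<in> carrier R" "C = cl x" by (rule quotientE)
        then show ?thesis
          using True k dual_quotient_value(2)[OF g x(1)] dual_quotient_value(2)[OF h x(1)]
            dual_quotient_value(2)[OF k(1) x(1)] R by (simp add: dual_def r_distr)
      next
        case False
        moreover have "k \<in> extensional (carrier Q)"
          using k(1) by (auto simp: dual_def mod_hom_def PiE_def)
        ultimately show ?thesis by (simp add: dual_def extensional_def)
      qed
      then have "g \<oplus>\<^bsub>dual R Q\<^esub> h = k" by (rule ext)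
      then show "g \<oplus>\<^bsub>dual R Q\<^esub> h \<in> carrier (dual R Q)" using k by simp
    qed
    have smult_closed: "a \<odot>\<^bsub>dual R Q\<^esub> g \<in> carrier (dual R Q)" and smult_val: "(a \<odot>\<^bsub>dual R Q\<^esub> g) (cl \<one>) = g (cl \<one>) \<otimes> a"
      if a: "a \<in> carrier R" and g: "g \<in> carrier (dual R Q)" for a g
    proof -
      show v: "(a \<odot>\<^bsub>dual R Q\<^esub> g) (cl \<one>) = g (cl \<one>) \<otimes> a" by (simp add: dual_def)
      have "g (cl \<one>) \<otimes> a \<in> right_ann R I"
        using opp.left_idealD(4)[OF ann] val g a by simp
      then obtain k where k: "k \<in> carrier (dual R Q)" "k (cl \<one>) = g (cl \<one>) \<otimes> a"
        by (rule dual_quotient_of_ann)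
      have R: "g (cl \<one>) \<in> carrier R" using val g by (auto simp: right_ann_def)
      have "(a \<odot>\<^bsub>dual R Q\<^esub> g) C = k C" for C
      proof (cases "C \<in> carrier Q")
        case True
        then obtain x where x: "x \<in> carrier R" "C = cl x" by (rule quotientE)
        then show ?thesis
          using True k dual_quotient_value(2)[OF g x(1)]
            dual_quotient_value(2)[OF k(1) x(1)] R a by (simp add: dual_def m_assoc)
      next
        case False
        moreover have "k \<in> extensional (carrier Q)"
          using k(1) by (auto simp: dual_def mod_hom_def PiE_def)
        ultimately show ?thesis by (simp add: dual_def extensional_def)
      qed
      then have "a \<odot>\<^bsub>dual R Q\<^esub> g = k" by (rule ext)
      then show "a \<odot>\<^bsub>dual R Q\<^esub> g \<in> carrier (dual R Q)" using k by simp
    qed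
    show ?thesis
      unfolding mod_hom_def
    proof (intro CollectI conjI ballI PiE_I)
      show "\<psi> g \<in> carrier (regular_module (opp R))" if "g \<in> carrier (dual R Q)" for g
        using that val f by (simp add: \<psi>_def left_linear_def)
      show "\<psi> g = undefined" if "g \<notin> carrier (dual R Q)" for g using that by (simp add: \<psi>_def)
      show "\<psi> (g \<oplus>\<^bsub>dual R Q\<^esub> h) = \<psi> g \<oplus>\<^bsub>regular_module (opp R)\<^esub> \<psi> h"
        if "g \<in> carrier (dual R Q)" "h \<in> carrier (dual R Q)" for g h
        using that f val add_closed add_val by (simp add: \<psi>_def left_linear_def)
      show "\<psi> (a \<odot>\<^bsub>dual R Q\<^esub> g) = a \<odot>\<^bsub>regular_module (opp R)\<^esub> \<psi> g"
        if "a \<in> carrier (opp R)" "g \<in> carrier (dual R Q)" for a g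
        using that f val smult_closed smult_val by (simp add: \<psi>_def left_linear_def)
    qed
  qed
  then have "\<psi> \<in> carrier (bidual R Q)" by (simp add: bidual_def dual_def)
  then obtain C where C: "C \<in> carrier Q" "eval_map R Q C = \<psi>"
    using bij by (metis bij_betw_imp_surj_on imageE)
  then obtain x where x: "x \<in> carrier R" "C = cl x" by (auto elim: quotientE)
  have "f a = x \<otimes> a" if a: "a \<in> right_ann R I" for a
  proof -
    obtain g where g: "g \<in> carrier (dual R Q)" "g (cl \<one>) = a" by (rule dual_quotient_of_ann[OF a])
    have "\<psi> g = x \<otimes> a" using C(2) x ev[OF x(1) g(1)] g(2) by simp
    then show ?thesis using g by (simp add: \<psi>_def)
  qed
  then show "\<exists>x\<in>carrier R. \<forall>a\<in>right_ann R I. f a = x \<otimes> a" using x(1) by blast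
qed

end

lemma (in ring) all_simple_left_reflexive_imp:
  assumes "all_simple_left_reflexive R"
  shows "simples_reflexive R"
  unfolding simples_reflexive_def
proof (intro allI impI)
  fix I assume max: "maximal_left_ideal R I"
  interpret ring_left_ideal R I
    using max by unfold_locales (simp add: maximal_left_ideal_def)
  have "reflexive_left R Q"
    using assms simple_quotient[OF max] unfolding all_simple_left_reflexive_def by blast
  then show "(\<forall>x\<in>carrier R - I. \<exists>a\<in>right_ann R I. x \<otimes> a \<noteq> \<zero>) \<and>
      (\<forall>f. left_linear (opp R) (right_ann R I) f \<longrightarrow> (\<exists>x\<in>carrier R. \<forall>a\<in>right_ann R I. f a = x \<otimes> a))"
    using reflexive_quotient_cond by blast
qed

lemma all_simple_right_reflexive_iff_opp:
  "all_simple_right_reflexive R \<longleftrightarrow> all_simple_left_reflexive (opp R)"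
  by (simp add: all_simple_right_reflexive_def all_simple_left_reflexive_def)

section \<open>Transport along ring isomorphisms\<close>

lemma left_ideal_ring_iso_image:
  assumes "ring R" "ring S" "h \<in> ring_iso R S" "left_ideal R I"
  shows "left_ideal S (h ` I)"
proof -
  interpret R: ring R by fact
  interpret S: ring S by fact
  have h: "\<And>x. x \<in> carrier R \<Longrightarrow> h x \<in> carrier S"
    "\<And>x y. x \<in> carrier R \<Longrightarrow> y \<in> carrier R \<Longrightarrow> h (x \<oplus>\<^bsub>R\<^esub> y) = h x \<oplus>\<^bsub>S\<^esub> h y"
    "\<And>x y. x \<in> carrier R \<Longrightarrow> y \<in> carrier R \<Longrightarrow> h (x \<otimes>\<^bsub>R\<^esub> y) = h x \<otimes>\<^bsub>S\<^esub> h y"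
    "h ` carrier R = carrier S"
    using assms(3) by (auto simp: ring_iso_def ring_hom_def bij_betw_def)
  have h0: "h \<zero>\<^bsub>R\<^esub> = \<zero>\<^bsub>S\<^esub>"
    using h(2)[of "\<zero>\<^bsub>R\<^esub>" "\<zero>\<^bsub>R\<^esub>"] h(1)[of "\<zero>\<^bsub>R\<^esub>"] by simp
  note ID = R.left_idealD[OF assms(4)]
  show ?thesis
    unfolding left_ideal_def
  proof (intro conjI ballI)
    show "h ` I \<subseteq> carrier S" using h(1) ID(1) by blast
    show "\<zero>\<^bsub>S\<^esub> \<in> h ` I" using h0 ID(2) by (metis imageI)
    fix y assume "y \<in> h ` I"
    then obtain x where x: "x \<in> I" "y = h x" by blast
    show "y \<oplus>\<^bsub>S\<^esub> z \<in> h ` I" if z: "z \<in> h ` I" for z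
    proof -
      obtain w where w: "w \<in> I" "z = h w" using z by blast
      have "y \<oplus>\<^bsub>S\<^esub> z = h (x \<oplus>\<^bsub>R\<^esub> w)" using h(2) x w ID(1) by simp
      then show ?thesis using ID(3) x w by blast
    qed
    show "b \<otimes>\<^bsub>S\<^esub> y \<in> h ` I" if b: "b \<in> carrier S" for b
    proof -
      obtain a where a: "a \<in> carrier R" "b = h a" using b h(4) by blast
      have "b \<otimes>\<^bsub>S\<^esub> y = h (a \<otimes>\<^bsub>R\<^esub> x)" using h(3) x a ID(1) by simp
      then show ?thesis using ID(4) x a by blast
    qed
  qed
qed

text \<open>Needed for algebras isomorphic to their opposite. The ideal-theoretic form of
  reflexivity only involves maximal left ideals, annihilators and linear maps between subsets, which
  \<open>h\<close> and its inverse carry over directly.\<close>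

lemma simples_reflexive_ring_iso:
  assumes RS: "ring R" "ring S" and iso: "h \<in> ring_iso R S" and S: "simples_reflexive S"
  shows "simples_reflexive R"
  unfolding simples_reflexive_def
proof (intro allI impI)
  interpret R: ring R by fact
  interpret S: ring S by fact
  have h: "\<And>x. x \<in> carrier R \<Longrightarrow> h x \<in> carrier S"
    "\<And>x y. x \<in> carrier R \<Longrightarrow> y \<in> carrier R \<Longrightarrow> h (x \<oplus>\<^bsub>R\<^esub> y) = h x \<oplus>\<^bsub>S\<^esub> h y"
    "\<And>x y. x \<in> carrier R \<Longrightarrow> y \<in> carrier R \<Longrightarrow> h (x \<otimes>\<^bsub>R\<^esub> y) = h x \<otimes>\<^bsub>S\<^esub> h y"
    "h ` carrier R = carrier S" "inj_on h (carrier R)"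
    using iso by (auto simp: ring_iso_def ring_hom_def bij_betw_def)
  have h0: "h \<zero>\<^bsub>R\<^esub> = \<zero>\<^bsub>S\<^esub>"
    using h(2)[of "\<zero>\<^bsub>R\<^esub>" "\<zero>\<^bsub>R\<^esub>"] h(1)[of "\<zero>\<^bsub>R\<^esub>"] by simp
  define k where "k = inv_into (carrier R) h"
  have iso': "k \<in> ring_iso S R"
    unfolding k_def using ring_iso_set_sym[OF RS(1) iso] .
  have k: "\<And>y. y \<in> carrier S \<Longrightarrow> k y \<in> carrier R" "\<And>y. y \<in> carrier S \<Longrightarrow> h (k y) = y"
    "\<And>x. x \<in> carrier R \<Longrightarrow> k (h x) = x"
    using h(4,5) by (auto simp: k_def inv_into_into f_inv_into_f)
  fix I assume max: "maximal_left_ideal R I"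
  then have I: "left_ideal R I" "I \<noteq> carrier R" by (auto simp: maximal_left_ideal_def)
  have IR: "I \<subseteq> carrier R" using R.left_idealD(1)[OF I(1)] by blast
  have maxS: "maximal_left_ideal S (h ` I)"
    unfolding maximal_left_ideal_def
  proof (intro conjI allI impI)
    show "left_ideal S (h ` I)" using left_ideal_ring_iso_image[OF RS iso I(1)] .
    have "h ` I \<noteq> h ` carrier R"
      using inj_on_image_eq_iff[OF h(5) IR order_refl] I(2) by simp
    then show "h ` I \<noteq> carrier S" using h(4) by simp
    fix J assume J: "left_ideal S J \<and> h ` I \<subset> J"
    have JS: "J \<subseteq> carrier S" using J S.left_idealD(1) by blast
    have "left_ideal R (k ` J)" using left_ideal_ring_iso_image[OF RS(2,1) iso'] J by blast
    have "h ` k ` J = (\<lambda>y. y) ` J"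
      unfolding image_image using k(2) JS by (intro image_cong) auto
    then have hk: "h ` k ` J = J" by simp
    have "I \<subseteq> k ` J"
    proof
      fix x assume "x \<in> I"
      then have "h x \<in> J" "k (h x) = x" using J k(3) IR by blast+
      then show "x \<in> k ` J" by (metis imageI)
    qed
    moreover have "I \<noteq> k ` J" using J hk by blast
    ultimately have "k ` J = carrier R"
      using max \<open>left_ideal R (k ` J)\<close> unfolding maximal_left_ideal_def by blast
    then show "J = carrier S" using hk h(4) by simp
  qed
  have ann: "h a \<in> right_ann S (h ` I)" if "a \<in> right_ann R I" for a
  proof -
    have aR: "a \<in> carrier R" and aI: "\<And>x. x \<in> I \<Longrightarrow> x \<otimes>\<^bsub>R\<^esub> a = \<zero>\<^bsub>R\<^esub>" using that by (auto simp: right_ann_def)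
    have "h x \<otimes>\<^bsub>S\<^esub> h a = \<zero>\<^bsub>S\<^esub>" if "x \<in> I" for x
      using h(3)[of x a] aI[OF that] aR that IR h0 by auto
    then show ?thesis using h(1)[OF aR] by (auto simp: right_ann_def)
  qed
  have annk: "k b \<in> right_ann R I" if "b \<in> right_ann S (h ` I)" for b
  proof -
    have bS: "b \<in> carrier S" and bI: "\<And>x. x \<in> I \<Longrightarrow> h x \<otimes>\<^bsub>S\<^esub> b = \<zero>\<^bsub>S\<^esub>" using that by (auto simp: right_ann_def)
    have "x \<otimes>\<^bsub>R\<^esub> k b = \<zero>\<^bsub>R\<^esub>" if "x \<in> I" for x
    proof -
      have xR: "x \<in> carrier R" using IR that by blast
      have "h (x \<otimes>\<^bsub>R\<^esub> k b) = h \<zero>\<^bsub>R\<^esub>" using h(3)[OF xR k(1)[OF bS]] k(2)[OF bS] bI[OF that] h0 by simp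
      then show ?thesis using inj_onD[OF h(5)] xR k(1)[OF bS] by simp
    qed
    then show ?thesis using k(1)[OF bS] by (simp add: right_ann_def)
  qed
  have S1: "\<And>x. x \<in> carrier S - h ` I \<Longrightarrow> \<exists>a\<in>right_ann S (h ` I). x \<otimes>\<^bsub>S\<^esub> a \<noteq> \<zero>\<^bsub>S\<^esub>"
    and S2: "\<And>f. left_linear (opp S) (right_ann S (h ` I)) f \<Longrightarrow>
        \<exists>x\<in>carrier S. \<forall>a\<in>right_ann S (h ` I). f a = x \<otimes>\<^bsub>S\<^esub> a"
    using S maxS unfolding simples_reflexive_def by blast+
  show "(\<forall>x\<in>carrier R - I. \<exists>a\<in>right_ann R I. x \<otimes>\<^bsub>R\<^esub> a \<noteq> \<zero>\<^bsub>R\<^esub>) \<and>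
      (\<forall>f. left_linear (opp R) (right_ann R I) f \<longrightarrow>
        (\<exists>x\<in>carrier R. \<forall>a\<in>right_ann R I. f a = x \<otimes>\<^bsub>R\<^esub> a))"
  proof (intro conjI ballI allI impI)
    fix x assume x: "x \<in> carrier R - I"
    then have "h x \<in> carrier S - h ` I"
      using h(1) inj_on_image_mem_iff[OF h(5) _ IR] by simp
    then obtain b where b: "b \<in> right_ann S (h ` I)" "h x \<otimes>\<^bsub>S\<^esub> b \<noteq> \<zero>\<^bsub>S\<^esub>" using S1 by blast
    have bS: "b \<in> carrier S" using b by (simp add: right_ann_def)
    have "h (x \<otimes>\<^bsub>R\<^esub> k b) = h x \<otimes>\<^bsub>S\<^esub> b" using h(3) k(1,2)[OF bS] x by simp
    then have "x \<otimes>\<^bsub>R\<^esub> k b \<noteq> \<zero>\<^bsub>R\<^esub>" using b(2) h0 by auto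
    then show "\<exists>a\<in>right_ann R I. x \<otimes>\<^bsub>R\<^esub> a \<noteq> \<zero>\<^bsub>R\<^esub>" using annk[OF b(1)] by blast
  next
    fix f assume f: "left_linear (opp R) (right_ann R I) f"
    have fD: "\<And>a. a \<in> right_ann R I \<Longrightarrow> f a \<in> carrier R"
      "\<And>a b. a \<in> right_ann R I \<Longrightarrow> b \<in> right_ann R I \<Longrightarrow> f (a \<oplus>\<^bsub>R\<^esub> b) = f a \<oplus>\<^bsub>R\<^esub> f b"
      "\<And>a r. a \<in> right_ann R I \<Longrightarrow> r \<in> carrier R \<Longrightarrow> f (a \<otimes>\<^bsub>R\<^esub> r) = f a \<otimes>\<^bsub>R\<^esub> r"
      using f by (auto simp: left_linear_def)
    have kD: "k (x \<oplus>\<^bsub>S\<^esub> y) = k x \<oplus>\<^bsub>R\<^esub> k y" "k (x \<otimes>\<^bsub>S\<^esub> y) = k x \<otimes>\<^bsub>R\<^esub> k y"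
      if "x \<in> carrier S" "y \<in> carrier S" for x y
      using iso' that by (auto simp: ring_iso_def ring_hom_def)
    have annS: "b \<in> carrier S" if "b \<in> right_ann S (h ` I)" for b using that by (simp add: right_ann_def)
    \<comment> \<open>Conjugation by the isomorphism makes \<open>f\<close> a map on the annihilator
      in \<open>S\<close>; the multiplier found there is pulled back by \<open>k\<close>.\<close>
    have "left_linear (opp S) (right_ann S (h ` I)) (\<lambda>b. h (f (k b)))"
      unfolding left_linear_def
      using annk annS fD kD h k(1,2) by simp
    then obtain y where y: "y \<in> carrier S" "\<And>b. b \<in> right_ann S (h ` I) \<Longrightarrow> h (f (k b)) = y \<otimes>\<^bsub>S\<^esub> b"
      using S2 by blast
    have "f a = k y \<otimes>\<^bsub>R\<^esub> a" if a: "a \<in> right_ann R I" for a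
    proof -
      have aR: "a \<in> carrier R" using a by (simp add: right_ann_def)
      have "h (f a) = y \<otimes>\<^bsub>S\<^esub> h a" using y(2)[OF ann[OF a]] k(3)[OF aR] by simp
      then have "k (h (f a)) = k y \<otimes>\<^bsub>R\<^esub> a" using kD(2)[OF y(1) h(1)[OF aR]] k(3)[OF aR] by simp
      then show ?thesis using k(3) fD(1)[OF a] by simp
    qed
    then show "\<exists>x\<in>carrier R. \<forall>a\<in>right_ann R I. f a = x \<otimes>\<^bsub>R\<^esub> a" using k(1)[OF y(1)] by blast
  qed
qed

section \<open>Artin algebras and the conclusion\<close>

lemma artin_algebra_chain_conditions:
  assumes A: "artin_algebra K A"
  shows "acc_on {I. left_ideal A I}" "acc_on {I. left_ideal (opp A) I}"
    and "dcc_on {I. left_ideal A I}" "dcc_on {I. left_ideal (opp A) I}"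
proof -
  interpret K: module K A using A by (simp add: artin_algebra_def)
  interpret A: ring A using A by (simp add: artin_algebra_def)
  have K: "dcc_on {I. ideal I K}"
    using A by (intro artinian_cring_dcc) (simp add: artin_algebra_def)
  obtain S where "finite S" "S \<subseteq> carrier A"
    "\<And>x. x \<in> carrier A \<Longrightarrow> \<exists>c \<in> S \<rightarrow> carrier K. x = (\<Oplus>\<^bsub>A\<^esub>s\<in>S. c s \<odot>\<^bsub>A\<^esub> s)"
    using A unfolding artin_algebra_def by blast
  then have dcc: "dcc_on {U. submodule U K A}"
    by (rule K.finitely_generated_dcc[OF K])
  have acc: "acc_on {U. submodule U K A}"
    by (rule K.dcc_imp_acc[OF K dcc])
  have bilinear: "(r \<odot>\<^bsub>A\<^esub> x) \<otimes>\<^bsub>A\<^esub> y = r \<odot>\<^bsub>A\<^esub> (x \<otimes>\<^bsub>A\<^esub> y)" "x \<otimes>\<^bsub>A\<^esub> (r \<odot>\<^bsub>A\<^esub> y) = r \<odot>\<^bsub>A\<^esub> (x \<otimes>\<^bsub>A\<^esub> y)"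
    if "r \<in> carrier K" "x \<in> carrier A" "y \<in> carrier A" for r x y
    using A that by (simp_all add: artin_algebra_def)
  \<comment> \<open>A scalar \<open>r\<close> acts as left and as right multiplication by the
    element \<open>r 1\<close> of \<open>A\<close>, so one-sided ideals on either side are stable
    under \<open>K\<close>.\<close>
  have left: "submodule I K A" if I: "left_ideal A I" for I
  proof (rule K.submoduleI')
    show "r \<odot>\<^bsub>A\<^esub> x \<in> I" if "r \<in> carrier K" "x \<in> I" for r x
    proof -
      have xA: "x \<in> carrier A" using I \<open>x \<in> I\<close> by (auto simp: left_ideal_def)
      have "r \<odot>\<^bsub>A\<^esub> x = (r \<odot>\<^bsub>A\<^esub> \<one>\<^bsub>A\<^esub>) \<otimes>\<^bsub>A\<^esub> x" using bilinear(1)[OF that(1) A.one_closed xA] xA by simp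
      moreover have "r \<odot>\<^bsub>A\<^esub> \<one>\<^bsub>A\<^esub> \<in> carrier A" using that by simp
      ultimately show ?thesis using I \<open>x \<in> I\<close> by (simp add: left_ideal_def)
    qed
  qed (use I in \<open>auto simp: left_ideal_def\<close>)
  have right: "submodule I K A" if I: "left_ideal (opp A) I" for I
  proof (rule K.submoduleI')
    show "r \<odot>\<^bsub>A\<^esub> x \<in> I" if "r \<in> carrier K" "x \<in> I" for r x
    proof -
      have xA: "x \<in> carrier A" using I \<open>x \<in> I\<close> by (auto simp: left_ideal_def)
      have "r \<odot>\<^bsub>A\<^esub> x = x \<otimes>\<^bsub>A\<^esub> (r \<odot>\<^bsub>A\<^esub> \<one>\<^bsub>A\<^esub>)" using bilinear(2)[OF that(1) xA A.one_closed] xA by simp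
      moreover have "r \<odot>\<^bsub>A\<^esub> \<one>\<^bsub>A\<^esub> \<in> carrier A" using that by simp
      ultimately show ?thesis using I \<open>x \<in> I\<close> by (simp add: left_ideal_def)
    qed
  qed (use I in \<open>auto simp: left_ideal_def\<close>)
  show "acc_on {I. left_ideal A I}" "acc_on {I. left_ideal (opp A) I}"
    using left right by (auto intro!: acc_on_subset[OF acc])
  show "dcc_on {I. left_ideal A I}" "dcc_on {I. left_ideal (opp A) I}"
    using left right by (auto intro!: dcc_on_subset[OF dcc])
qed

theorem selfinjective_if_simples_reflexive:
  assumes A: "artin_algebra K A" and "simples_reflexive A" "simples_reflexive (opp A)"
  shows "selfinjective TYPE('m) TYPE('n) A"
proof -
  interpret ring A using A by (simp add: artin_algebra_def)
  interpret opp: simples_reflexive_ring "opp A"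
    by (intro simples_reflexive_ring.intro simples_reflexive_ring_axioms.intro ring_opp)
      (simp_all add: artin_algebra_chain_conditions[OF A] assms(2,3))
  show ?thesis
    unfolding selfinjective_def
    by (rule ring.injective_regular_module[OF ring_opp]) (rule opp.left_linear_extends)
qed

theorem proposition3p15:
  fixes K :: "('k, 'b) ring_scheme" and A :: "('k, 'a) module"
  assumes "artin_algebra K A"
    and "basic_ring A"
    and "\<not> semisimple_ring A"
  shows "(all_simple_left_reflexive A \<and> all_simple_right_reflexive A
            \<longrightarrow> selfinjective TYPE('m) TYPE('n) A) \<and>
         (algebra_iso K A (opp A) \<noteq> {} \<and> all_simple_right_reflexive A
            \<longrightarrow> selfinjective TYPE('m) TYPE('n) A)"
proof -
  interpret ring A using assms(1) by (simp add: artin_algebra_def)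
  have right: "simples_reflexive (opp A)" if "all_simple_right_reflexive A"
    using ring.all_simple_left_reflexive_imp[OF ring_opp] that
    by (simp add: all_simple_right_reflexive_iff_opp)
  show ?thesis
  proof (intro conjI impI)
    assume "all_simple_left_reflexive A \<and> all_simple_right_reflexive A"
    then show "selfinjective TYPE('m) TYPE('n) A"
      using selfinjective_if_simples_reflexive[OF assms(1)] all_simple_left_reflexive_imp right by blast
  next
    assume asm: "algebra_iso K A (opp A) \<noteq> {} \<and> all_simple_right_reflexive A"
    then obtain h where "h \<in> ring_iso A (opp A)" by (auto simp: algebra_iso_def)
    \<comment> \<open>An isomorphism of \<open>A\<close> onto its opposite brings the condition for
      simple right modules to the left side, which reduces this case to the first.\<close>
    then have "simples_reflexive A"
      using simples_reflexive_ring_iso[OF ring_axioms ring_opp] right asm by blast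
    then show "selfinjective TYPE('m) TYPE('n) A"
      using selfinjective_if_simples_reflexive[OF assms(1)] right asm by blast
  qed
qed

end
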